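(* Let $\overline{\gamma}>0$ and $q\in[0,1]$. Let $\theta$ be a random variable uniformly distributed between $0$ and $\pi$, and let $R|\theta$ be an exponentially distributed random variable, conditioned on $\theta$, with pdf $$f_{R|\theta}(x)=\frac{1}{\gamma(\theta,q)}e^{-x/\gamma(\theta,q)},\qquad x\ge 0,$$ where $$\gamma(\theta,q)\triangleq\overline{\gamma}\left(1-\frac{1-q^2}{1+q^2}\cos\theta\right)=\mathbb{E}\{R|\theta\}.$$ Then the unconditional random variable $R$, with pdf $$f_R(x)=\frac{1}{\pi}\int_0^\pi\frac{1}{\gamma(\theta,q)}e^{-x/\gamma(\theta,q)}\,d\theta,$$ follows a squared Hoyt distribution with average $\mathbb{E}\{R\}=\overline{\gamma}$ and parameter $q$; that is, this integral is an alternative expression for the squared Hoyt pdf $$f_R(x)=\frac{1+q^2}{2q\overline{\gamma}}\exp\left[-\frac{(1+q^2)^2x}{4q^2\overline{\gamma}}\right]I_0\left(\frac{(1-q^4)x}{4q^2\overline{\gamma}}\right).$$ The cdf of $R$ is given by $$F_R(x)=1-\frac{1}{\pi}\int_0^\pi e^{-x/\gamma(\theta,q)}\,d\theta.$$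
   Context: $I_0$ is the modified Bessel function of the first kind and order zero. The squared Hoyt distribution is the distribution of $R=X^2+Y^2$, where $X,Y$ are independent (jointly Gaussian) zero-mean Gaussian random variables with variances $\sigma_x^2$ and $\sigma_y^2$, with $\sigma_y\le\sigma_x$ without loss of generality. Its parameters are the average $\overline{\gamma}=\mathbb{E}\{R\}$ and $q=\sigma_y/\sigma_x\in[0,1]$, and its pdf is given by the Bessel-function expression displayed in the claim.
   Formalization: The Bessel-function expression divides by zero at q = 0, so its equality with the integral is stated for 0 < q ≤ 1 and all x ≥ 0; at q = 0 it is read as the limit q → 0+ for x > 0 (at x = 0 the integral diverges). All other claims cover every q in [0,1]. *)

theory Defs
  imports "HOL-Probability.Probability"
begin

definition bessel_I0 :: "real \<Rightarrow> real" where
  "bessel_I0 x = (\<Sum>k. (x / 2) ^ (2 * k) / (fact k)\<^sup>2)"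

text \<open>The law N(0, s^2). The degenerate case s = 0 has to be separated, because
  \<open>normal_density 0 0\<close> is not a probability density.\<close>
definition centered_gaussian :: "real \<Rightarrow> real measure" where
  "centered_gaussian s =
     (if s = 0 then return borel 0 else density lborel (\<lambda>x. ennreal (normal_density 0 s x)))"

text \<open>The sample space is taken to have type \<open>real \<times> real\<close> because a definition cannot
  quantify over types; this loses nothing, as the law of \<open>X\<^sup>2 + Y\<^sup>2\<close> depends only on the
  joint law of X and Y.\<close>
definition squared_hoyt :: "real \<Rightarrow> real \<Rightarrow> real measure \<Rightarrow> bool" where
  "squared_hoyt g q D \<longleftrightarrow>
     (\<exists>(N :: (real \<times> real) measure) X Y \<sigma>x \<sigma>y.
        prob_space N \<and>
        prob_space.indep_var N borel X borel Y \<and>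
        distr N borel X = centered_gaussian \<sigma>x \<and>
        distr N borel Y = centered_gaussian \<sigma>y \<and>
        0 \<le> \<sigma>y \<and> \<sigma>y \<le> \<sigma>x \<and> 0 < \<sigma>x \<and>
        q = \<sigma>y / \<sigma>x \<and>
        g = (\<integral>\<omega>. (X \<omega>)\<^sup>2 + (Y \<omega>)\<^sup>2 \<partial>N) \<and>
        D = distr N borel (\<lambda>\<omega>. (X \<omega>)\<^sup>2 + (Y \<omega>)\<^sup>2))"

text \<open>Meaningful for \<open>q > 0\<close> and \<open>x \<ge> 0\<close> only; at \<open>q = 0\<close> the usual reading is the limit
  as q decreases to 0.\<close>
definition squared_hoyt_pdf :: "real \<Rightarrow> real \<Rightarrow> real \<Rightarrow> real" where
  "squared_hoyt_pdf g q x =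
     (1 + q\<^sup>2) / (2 * q * g) * exp (- ((1 + q\<^sup>2)\<^sup>2 * x / (4 * q\<^sup>2 * g)))
       * bessel_I0 ((1 - q ^ 4) * x / (4 * q\<^sup>2 * g))"

definition hoyt_gamma :: "real \<Rightarrow> real \<Rightarrow> real \<Rightarrow> real" where
  "hoyt_gamma g \<theta> q = g * (1 - (1 - q\<^sup>2) / (1 + q\<^sup>2) * cos \<theta>)"

text \<open>\<open>f t\<close> is a conditional density of R given \<open>T = t\<close>. Only the values of \<open>f t\<close> for almost
  every t (with respect to the law of T) matter, and for almost every t the function \<open>f t\<close>
  integrates to 1, as the case \<open>B = UNIV\<close> shows.\<close>
definition conditional_pdf ::
    "'a measure \<Rightarrow> ('a \<Rightarrow> real) \<Rightarrow> ('a \<Rightarrow> real) \<Rightarrow> (real \<Rightarrow> real \<Rightarrow> real) \<Rightarrow> bool" where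
  "conditional_pdf M T R f \<longleftrightarrow>
     T \<in> borel_measurable M \<and> R \<in> borel_measurable M \<and>
     (\<lambda>(t, x). f t x) \<in> borel_measurable (borel \<Otimes>\<^sub>M borel) \<and>
     (\<forall>t x. 0 \<le> f t x) \<and>
     (\<forall>A \<in> sets borel. \<forall>B \<in> sets borel.
        emeasure M {\<omega> \<in> space M. T \<omega> \<in> A \<and> R \<omega> \<in> B} =
        (\<integral>\<^sup>+t\<in>A. (\<integral>\<^sup>+x\<in>B. ennreal (f t x) \<partial>lborel) \<partial>(distr M borel T)))"

end

theory Submission
  imports Defs
begin

text \<open>
  The mixture density and the Bessel expression are linked by the relation between the eccentric
  anomaly \<open>E\<close> and the true anomaly \<open>v\<close> of an ellipse with eccentricity
  \<open>k = (1 - q\<^sup>2) / (1 + q\<^sup>2)\<close>: substituting \<open>cos E = (k + cos v) / (1 + k cos v)\<close> gives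
  \<open>1 - k cos E = (1 - k\<^sup>2) / (1 + k cos v)\<close>, so that \<open>1 / \<gamma>\<close> becomes affine in \<open>cos v\<close>, and the
  remaining integral of \<open>exp (z cos v)\<close> is \<open>\<pi> I\<^sub>0(z)\<close>.

  For the Gaussian representation let \<open>U\<close>, \<open>V\<close> be independent standard normal variables, and put
  \<open>U = s V\<close> with \<open>s = tan (\<theta> / 2)\<close> on the positive quadrant. Then
  \<open>\<sigma>\<^sub>x\<^sup>2 U\<^sup>2 + \<sigma>\<^sub>y\<^sup>2 V\<^sup>2 = \<gamma>(\<theta>, q) W\<close>, where \<open>W = (U\<^sup>2 + V\<^sup>2) / 2\<close> is a standard exponential variable
  independent of \<open>\<theta>\<close>, and \<open>\<theta>\<close> is uniform on \<open>(0, \<pi>)\<close>. Hence the two laws have the same tails,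
  including the degenerate case \<open>q = 0\<close>.
\<close>

section \<open>Size and positivity of the conditional mean\<close>

lemma hoyt_ratio_bounds:
  fixes q :: real
  assumes "0 \<le> q" "q \<le> 1"
  shows "0 \<le> (1 - q\<^sup>2) / (1 + q\<^sup>2)" "(1 - q\<^sup>2) / (1 + q\<^sup>2) \<le> 1"
    "0 < q \<Longrightarrow> (1 - q\<^sup>2) / (1 + q\<^sup>2) < 1"
proof -
  have "q\<^sup>2 \<le> 1" using assms by (simp add: power_le_one)
  moreover have "0 < 1 + q\<^sup>2" by (simp add: add_pos_nonneg)
  ultimately show "0 \<le> (1 - q\<^sup>2) / (1 + q\<^sup>2)" "(1 - q\<^sup>2) / (1 + q\<^sup>2) \<le> 1"
    "0 < q \<Longrightarrow> (1 - q\<^sup>2) / (1 + q\<^sup>2) < 1"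
    by (auto simp: field_simps)
qed

lemma hoyt_gamma_bounds:
  assumes "0 < g" "0 \<le> q" "q \<le> 1"
  shows "0 \<le> hoyt_gamma g t q" "hoyt_gamma g t q \<le> 2 * g"
proof -
  have "\<bar>(1 - q\<^sup>2) / (1 + q\<^sup>2) * cos t\<bar> \<le> 1"
    using hoyt_ratio_bounds[OF assms(2,3)] abs_cos_le_one[of t]
    unfolding abs_mult by (intro mult_le_one) auto
  then have "0 \<le> 1 - (1 - q\<^sup>2) / (1 + q\<^sup>2) * cos t" "1 - (1 - q\<^sup>2) / (1 + q\<^sup>2) * cos t \<le> 2"
    by linarith+
  then show "0 \<le> hoyt_gamma g t q" "hoyt_gamma g t q \<le> 2 * g"
    unfolding hoyt_gamma_def using assms(1) by (simp_all add: mult.commute)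
qed

text \<open>At \<open>q = 0\<close> the ratio \<open>(1 - q\<^sup>2) / (1 + q\<^sup>2)\<close> is 1
  and the mean vanishes at \<open>t = 0\<close>. Positivity must therefore come from
  \<open>cos t < 1\<close>, whence the restriction to \<open>0 < t\<close>.\<close>

lemma hoyt_gamma_pos:
  assumes "0 < g" "0 \<le> q" "q \<le> 1" "0 < t" "t \<le> pi"
  shows "0 < hoyt_gamma g t q"
proof -
  have c: "cos t < 1" using cos_monotone_0_pi[of 0 t] assms by simp
  have "(1 - q\<^sup>2) / (1 + q\<^sup>2) * cos t < 1"
  proof (cases "cos t \<le> 0")
    case True
    then have "(1 - q\<^sup>2) / (1 + q\<^sup>2) * cos t \<le> 0"
      using hoyt_ratio_bounds[OF assms(2,3)] by (intro mult_nonneg_nonpos) auto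
    then show ?thesis by linarith
  next
    case False
    then have "(1 - q\<^sup>2) / (1 + q\<^sup>2) * cos t \<le> 1 * cos t"
      using hoyt_ratio_bounds[OF assms(2,3)] by (intro mult_right_mono) auto
    then show ?thesis using c by linarith
  qed
  then show ?thesis using assms by (simp add: hoyt_gamma_def)
qed

text \<open>For \<open>q > 0\<close> the ratio stays below 1, so no angle is exceptional; this makes
  the mixture integrands continuous on the closed interval.\<close>

lemma hoyt_gamma_pos_nondegenerate:
  assumes "0 < g" "0 < q" "q \<le> 1"
  shows "0 < hoyt_gamma g t q"
proof -
  define k where "k = (1 - q\<^sup>2) / (1 + q\<^sup>2)"
  have k: "0 \<le> k" "k < 1" using hoyt_ratio_bounds[of q] assms by (auto simp: k_def)
  then have "\<bar>k * cos t\<bar> \<le> k" unfolding abs_mult by (simp add: mult_left_le)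
  then have "k * cos t < 1" using k by linarith
  then show ?thesis using assms by (simp add: hoyt_gamma_def k_def)
qed

lemma continuous_hoyt_gamma: "continuous_on S (\<lambda>t. hoyt_gamma g t q)"
  unfolding hoyt_gamma_def by (intro continuous_intros)

lemma measurable_hoyt_gamma [measurable]:
  "(\<lambda>t. hoyt_gamma g t q) \<in> borel_measurable borel"
  unfolding hoyt_gamma_def by measurable

section \<open>Conditional densities\<close>

text \<open>The definition speaks of rectangles only. Both sides are integrals of \<open>h\<close>
  against a measure on the line, on the left the law of \<open>R\<close> restricted to the event
  that \<open>T\<close> lies in \<open>A\<close>; the rectangles show that these two measures
  coincide.\<close>

lemma conditional_pdf_nn_integral:
  assumes "prob_space M" "conditional_pdf M T R f" "A \<in> sets borel"
    and [measurable]: "h \<in> borel_measurable borel"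
  shows "(\<integral>\<^sup>+\<omega>. h (R \<omega>) * indicator A (T \<omega>) \<partial>M) =
         (\<integral>\<^sup>+t\<in>A. (\<integral>\<^sup>+x. h x * ennreal (f t x) \<partial>lborel) \<partial>distr M borel T)"
proof -
  interpret M: prob_space M by fact
  note [measurable] = \<open>A \<in> sets borel\<close>
  have [measurable]: "T \<in> borel_measurable M" "R \<in> borel_measurable M"
    and f [measurable]: "(\<lambda>(t, x). f t x) \<in> borel_measurable (borel \<Otimes>\<^sub>M borel)"
    and rect: "\<And>B. B \<in> sets borel \<Longrightarrow> emeasure M {\<omega> \<in> space M. T \<omega> \<in> A \<and> R \<omega> \<in> B} =
        (\<integral>\<^sup>+t\<in>A. (\<integral>\<^sup>+x\<in>B. ennreal (f t x) \<partial>lborel) \<partial>distr M borel T)"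
    using assms by (auto simp: conditional_pdf_def)
  interpret T: prob_space "distr M borel T" by (rule M.prob_space_distr) simp
  interpret pair_sigma_finite lborel "distr M borel T" ..
  \<comment> \<open>Tonelli exhibits the right-hand side as the integral of \<open>h\<close> against
    one density. It is needed twice: for indicators, to identify the measures, and for the given
    \<open>h\<close>.\<close>
  have swap: "(\<integral>\<^sup>+t\<in>A. (\<integral>\<^sup>+x. h x * ennreal (f t x) \<partial>lborel) \<partial>distr M borel T) =
      (\<integral>\<^sup>+x. h x * (\<integral>\<^sup>+t\<in>A. ennreal (f t x) \<partial>distr M borel T) \<partial>lborel)"
    if [measurable]: "h \<in> borel_measurable borel" for h :: "real \<Rightarrow> ennreal"
  proof -
    have "(\<integral>\<^sup>+t\<in>A. (\<integral>\<^sup>+x. h x * ennreal (f t x) \<partial>lborel) \<partial>distr M borel T) =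
        (\<integral>\<^sup>+t. (\<integral>\<^sup>+x. h x * ennreal (f t x) * indicator A t \<partial>lborel) \<partial>distr M borel T)"
      by (intro nn_integral_cong nn_integral_multc[symmetric]) simp
    also have "\<dots> = (\<integral>\<^sup>+x. (\<integral>\<^sup>+t. h x * ennreal (f t x) * indicator A t \<partial>distr M borel T) \<partial>lborel)"
      by (intro Fubini') measurable
    also have "\<dots> = (\<integral>\<^sup>+x. h x * (\<integral>\<^sup>+t\<in>A. ennreal (f t x) \<partial>distr M borel T) \<partial>lborel)"
      by (intro nn_integral_cong) (simp add: nn_integral_cmult[symmetric] mult.assoc)
    finally show ?thesis .
  qed
  have "distr (density M (\<lambda>\<omega>. indicator A (T \<omega>))) borel R =
      density lborel (\<lambda>x. \<integral>\<^sup>+t\<in>A. ennreal (f t x) \<partial>distr M borel T)"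
  proof (rule measure_eqI)
    fix B assume "B \<in> sets (distr (density M (\<lambda>\<omega>. indicator A (T \<omega>))) borel R)"
    then have [measurable]: "B \<in> sets borel" by simp
    have "emeasure (distr (density M (\<lambda>\<omega>. indicator A (T \<omega>))) borel R) B =
        (\<integral>\<^sup>+\<omega>. indicator {\<omega> \<in> space M. T \<omega> \<in> A \<and> R \<omega> \<in> B} \<omega> \<partial>M)"
      by (subst emeasure_distr)
        (auto simp: emeasure_density simp del: nn_integral_indicator
          intro!: nn_integral_cong split: split_indicator)
    also have "\<dots> = (\<integral>\<^sup>+t\<in>A. (\<integral>\<^sup>+x. indicator B x * ennreal (f t x) \<partial>lborel) \<partial>distr M borel T)"
      by (simp add: rect mult.commute)
    also have "\<dots> = (\<integral>\<^sup>+x. indicator B x * (\<integral>\<^sup>+t\<in>A. ennreal (f t x) \<partial>distr M borel T) \<partial>lborel)"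
      by (rule swap) simp
    finally show "emeasure (distr (density M (\<lambda>\<omega>. indicator A (T \<omega>))) borel R) B =
        emeasure (density lborel (\<lambda>x. \<integral>\<^sup>+t\<in>A. ennreal (f t x) \<partial>distr M borel T)) B"
      by (simp add: emeasure_density mult.commute)
  qed simp
  then have "(\<integral>\<^sup>+x. h x \<partial>distr (density M (\<lambda>\<omega>. indicator A (T \<omega>))) borel R) =
      (\<integral>\<^sup>+x. h x \<partial>density lborel (\<lambda>x. \<integral>\<^sup>+t\<in>A. ennreal (f t x) \<partial>distr M borel T))"
    by simp
  then have "(\<integral>\<^sup>+\<omega>. h (R \<omega>) * indicator A (T \<omega>) \<partial>M) =
      (\<integral>\<^sup>+x. h x * (\<integral>\<^sup>+t\<in>A. ennreal (f t x) \<partial>distr M borel T) \<partial>lborel)"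
    by (simp add: nn_integral_distr[of R] nn_integral_density mult.commute)
  then show ?thesis by (simp only: swap assms)
qed

text \<open>Marginalization: with \<open>A = UNIV\<close> and an indicator as test function, Tonelli
  moves the average over \<open>T\<close> inside the integral over \<open>x\<close>.\<close>

lemma conditional_pdf_distr:
  assumes M: "prob_space M" and c: "conditional_pdf M T R f"
  shows "distr M borel R = density lborel (\<lambda>x. \<integral>\<^sup>+t. ennreal (f t x) \<partial>distr M borel T)"
proof (rule measure_eqI)
  interpret M: prob_space M by fact
  have [measurable]: "T \<in> borel_measurable M" "R \<in> borel_measurable M"
    "(\<lambda>(t, x). f t x) \<in> borel_measurable (borel \<Otimes>\<^sub>M borel)"
    using c by (auto simp: conditional_pdf_def)
  interpret T: prob_space "distr M borel T" by (rule M.prob_space_distr) simp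
  interpret pair_sigma_finite lborel "distr M borel T" ..
  fix B assume "B \<in> sets (distr M borel R)"
  then have [measurable]: "B \<in> sets borel" by simp
  have "emeasure (distr M borel R) B = (\<integral>\<^sup>+x. indicator B x \<partial>distr M borel R)"
    by simp
  also have "\<dots> = (\<integral>\<^sup>+\<omega>. indicator B (R \<omega>) * indicator UNIV (T \<omega>) \<partial>M)"
    by (subst nn_integral_distr) auto
  also have "\<dots> = (\<integral>\<^sup>+t\<in>UNIV. (\<integral>\<^sup>+x. indicator B x * ennreal (f t x) \<partial>lborel) \<partial>distr M borel T)"
    by (rule conditional_pdf_nn_integral[OF M c]) auto
  also have "\<dots> = (\<integral>\<^sup>+t. (\<integral>\<^sup>+x. ennreal (f t x) * indicator B x \<partial>lborel) \<partial>distr M borel T)"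
    by (simp add: mult.commute)
  also have "\<dots> = (\<integral>\<^sup>+x. (\<integral>\<^sup>+t. ennreal (f t x) * indicator B x \<partial>distr M borel T) \<partial>lborel)"
    by (intro Fubini') measurable
  also have "\<dots> = emeasure (density lborel (\<lambda>x. \<integral>\<^sup>+t. ennreal (f t x) \<partial>distr M borel T)) B"
    by (simp add: emeasure_density nn_integral_multc)
  finally show "emeasure (distr M borel R) B =
      emeasure (density lborel (\<lambda>x. \<integral>\<^sup>+t. ennreal (f t x) \<partial>distr M borel T)) B" .
qed simp

section \<open>The Bessel expression\<close>

text \<open>Wallis recursion: \<open>cos t ^ (n + 1) * sin t\<close> vanishes at both ends, so its
  derivative integrates to zero, which links the exponents \<open>n + 2\<close> and
  \<open>n\<close>.\<close>

lemma cos_power_integral: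
  "((\<lambda>t. cos t ^ (2 * k)) has_integral pi * fact (2 * k) / (4 ^ k * (fact k)\<^sup>2)) {0..pi}"
  "((\<lambda>t. cos t ^ (2 * k + 1)) has_integral 0) {0..pi}"
proof -
  have rec: "((\<lambda>t. cos t ^ (n + 2)) has_integral real (n + 1) / real (n + 2) * I) {0..pi}"
    if "((\<lambda>t. cos t ^ n) has_integral I) {0..pi}" for n I
  proof -
    have "((\<lambda>t. cos t ^ (n + 1) * sin t) has_real_derivative
        (real (n + 2) * cos t ^ (n + 2) - real (n + 1) * cos t ^ n)) (at t within {0..pi})" for t
    proof -
      have "cos t ^ n * (sin t)\<^sup>2 = cos t ^ n - cos t ^ (n + 2)"
        unfolding sin_squared_eq by (simp add: algebra_simps power2_eq_square)
      then have e: "real (n + 1) * (cos t ^ n * (sin t)\<^sup>2) =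
          real (n + 1) * (cos t ^ n - cos t ^ (n + 2))" by simp
      have "((\<lambda>t. cos t ^ (n + 1) * sin t) has_real_derivative
          cos t ^ (n + 2) - real (n + 1) * (cos t ^ n * (sin t)\<^sup>2)) (at t within {0..pi})"
        by (rule derivative_eq_intros refl | simp add: algebra_simps power2_eq_square)+
      then show ?thesis unfolding e by (simp add: algebra_simps)
    qed
    then have "((\<lambda>t. real (n + 2) * cos t ^ (n + 2) - real (n + 1) * cos t ^ n) has_integral
        cos pi ^ (n + 1) * sin pi - cos 0 ^ (n + 1) * sin 0) {0..pi}"
      by (intro fundamental_theorem_of_calculus)
        (auto simp: has_real_derivative_iff_has_vector_derivative[symmetric])
    from has_integral_add[OF this has_integral_mult_right[OF that, of "real (n + 1)"]]
    have "((\<lambda>t. real (n + 2) * cos t ^ (n + 2)) has_integral real (n + 1) * I) {0..pi}"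
      by simp
    from has_integral_mult_right[OF this, of "1 / real (n + 2)"] show ?thesis by simp
  qed
  show "((\<lambda>t. cos t ^ (2 * k)) has_integral pi * fact (2 * k) / (4 ^ k * (fact k)\<^sup>2)) {0..pi}"
  proof (induction k)
    case 0
    show ?case using has_integral_const_real[of "1::real" 0 pi] by simp
  next
    case (Suc k)
    have "real (2 * k + 1) / real (2 * k + 2) * (pi * fact (2 * k) / (4 ^ k * (fact k)\<^sup>2)) =
        pi * fact (2 * Suc k) / (4 ^ Suc k * (fact (Suc k))\<^sup>2)"
      by (simp add: divide_simps power2_eq_square) (simp add: algebra_simps)
    then show ?case using rec[OF Suc] by simp
  qed
  show "((\<lambda>t. cos t ^ (2 * k + 1)) has_integral 0) {0..pi}"
  proof (induction k)
    case 0
    have "(cos has_integral sin pi - sin 0) {0..pi}"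
      by (intro fundamental_theorem_of_calculus)
        (auto simp: has_real_derivative_iff_has_vector_derivative[symmetric] intro!: derivative_eq_intros)
    then show ?case by simp
  next
    case (Suc k)
    from rec[OF Suc] show ?case by simp
  qed
qed

text \<open>The exponential series is integrated term by term. Odd cosine moments vanish, and the
  even ones turn the factor \<open>1 / fact (2 * k)\<close> into the coefficient of the Bessel
  series; \<open>?w k\<close> is the k-th moment divided by \<open>pi\<close>.\<close>

lemma has_integral_exp_cos:
  "((\<lambda>t. exp (z * cos t)) has_integral pi * bessel_I0 z) {0..pi}"
proof -
  let ?w = "\<lambda>k. if even k then fact k / (4 ^ (k div 2) * (fact (k div 2))\<^sup>2) else (0::real)"
  have int: "((\<lambda>t. (z * cos t) ^ k / fact k) has_integral z ^ k / fact k * (pi * ?w k)) {0..pi}" for k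
  proof -
    have "((\<lambda>t. cos t ^ k) has_integral pi * ?w k) {0..pi}"
    proof (cases "even k")
      case True
      then obtain j where "k = 2 * j" by blast
      then show ?thesis using cos_power_integral(1)[of j] by simp
    next
      case False
      then obtain j where "k = 2 * j + 1" using oddE by blast
      then show ?thesis using cos_power_integral(2)[of j] by simp
    qed
    from has_integral_mult_right[OF this, of "z ^ k / fact k"] show ?thesis
      by (simp add: power_mult_distrib)
  qed
  have "uniform_limit {0..pi} (\<lambda>n t. \<Sum>k<n. (z * cos t) ^ k / fact k)
      (\<lambda>t. \<Sum>k. (z * cos t) ^ k / fact k) sequentially"
  proof (rule Weierstrass_m_test)
    show "summable (\<lambda>k. \<bar>z\<bar> ^ k / fact k)"
      using summable_exp[of "\<bar>z\<bar>"] by (simp add: divide_inverse mult.commute)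
    fix k t
    have "\<bar>z * cos t\<bar> \<le> \<bar>z\<bar>"
      unfolding abs_mult by (rule mult_right_le_one_le) auto
    then show "norm ((z * cos t) ^ k / fact k) \<le> \<bar>z\<bar> ^ k / fact k"
      by (simp add: power_abs power_mono divide_right_mono)
  qed
  moreover have "(\<Sum>k. (z * cos t) ^ k / fact k) = exp (z * cos t)" for t
    by (simp add: exp_def divide_inverse mult.commute)
  ultimately have ul: "uniform_limit (cbox 0 pi) (\<lambda>n t. \<Sum>k<n. (z * cos t) ^ k / fact k)
      (\<lambda>t. exp (z * cos t)) sequentially" by simp
  have part: "((\<lambda>t. \<Sum>k<n. (z * cos t) ^ k / fact k) has_integral
      (\<Sum>k<n. z ^ k / fact k * (pi * ?w k))) (cbox 0 pi)" for n
    using int by (intro has_integral_sum) auto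
  \<comment> \<open>Uniform convergence yields a limit \<open>J\<close> of the partial integrals
    without its value; uniqueness of integrals then identifies these with the partial sums.\<close>
  obtain I J where IJ: "\<And>n. ((\<lambda>t. \<Sum>k<n. (z * cos t) ^ k / fact k) has_integral I n) (cbox 0 pi)"
    "((\<lambda>t. exp (z * cos t)) has_integral J) (cbox 0 pi)" "I \<longlonglongrightarrow> J"
    by (rule uniform_limit_integral_cbox[OF ul]) (auto intro!: continuous_intros)
  have "I = (\<lambda>n. \<Sum>k<n. z ^ k / fact k * (pi * ?w k))"
    using has_integral_unique[OF IJ(1) part] by (rule ext)
  then have "(\<lambda>n. \<Sum>k<n. z ^ k / fact k * (pi * ?w k)) \<longlonglongrightarrow> J"
    using IJ(3) by simp
  then have s: "(\<lambda>k. z ^ k / fact k * (pi * ?w k)) sums J"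
    by (simp add: sums_def)
  have "(\<lambda>k. z ^ (2 * k) / fact (2 * k) * (pi * ?w (2 * k))) sums J"
    using s by (subst sums_mono_reindex[of "\<lambda>k. 2 * k"]) (auto simp: strict_mono_def elim!: evenE)
  also have "(\<lambda>k. z ^ (2 * k) / fact (2 * k) * (pi * ?w (2 * k))) =
      (\<lambda>k. pi * ((z / 2) ^ (2 * k) / (fact k)\<^sup>2))"
    by (rule ext) (simp add: power_divide power_mult)
  finally have "(\<lambda>k. pi * ((z / 2) ^ (2 * k) / (fact k)\<^sup>2)) sums J" .
  then have "(\<lambda>k. 1 / pi * (pi * ((z / 2) ^ (2 * k) / (fact k)\<^sup>2))) sums (1 / pi * J)"
    by (rule sums_mult)
  then have "(\<lambda>k. (z / 2) ^ (2 * k) / (fact k)\<^sup>2) sums (J / pi)"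
    by simp
  then have "J = pi * bessel_I0 z" by (simp add: bessel_I0_def sums_iff)
  with IJ(2) show ?thesis by simp
qed

lemma bessel_I0_minus [simp]: "bessel_I0 (- z) = bessel_I0 z"
  by (simp add: bessel_I0_def)

text \<open>The substitution from eccentric to true anomaly. Its Jacobian
  \<open>S / (1 + k * cos v)\<close> cancels the denominator left by \<open>1 / hoyt_gamma\<close>,
  so only a constant times the exponential of an affine function of \<open>cos v\<close>
  remains.\<close>

lemma hoyt_density_has_integral:
  assumes g: "0 < g" and q: "0 < q" "q \<le> 1"
  shows "((\<lambda>t. 1 / hoyt_gamma g t q * exp (- (x / hoyt_gamma g t q)))
    has_integral pi * squared_hoyt_pdf g q x) {0..pi}"
proof -
  define k where "k = (1 - q\<^sup>2) / (1 + q\<^sup>2)"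
  \<comment> \<open>\<open>S\<close> is the positive square root of \<open>1 - k\<^sup>2\<close>,
    the ratio of the minor to the major axis of the ellipse.\<close>
  define S where "S = 2 * q / (1 + q\<^sup>2)"
  have q1: "1 + q\<^sup>2 > 0" by (simp add: add_pos_nonneg)
  have S: "0 < S" "1 - k\<^sup>2 = S\<^sup>2"
    using q q1 by (simp add: S_def, simp add: S_def k_def power_divide field_simps)
      (simp add: power2_eq_square algebra_simps)
  have k: "0 \<le> k" "k < 1" using hoyt_ratio_bounds[of q] q by (auto simp: k_def)
  have den: "0 < 1 + k * cos v" for v
  proof -
    have "\<bar>k * cos v\<bar> \<le> k" unfolding abs_mult using k by (simp add: mult_left_le)
    then show ?thesis using k by linarith
  qed
  define c where "c v = (k + cos v) / (1 + k * cos v)" for v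
  define E where "E v = arccos (c v)" for v
  \<comment> \<open>These two factorizations give the range of \<open>c\<close> and, multiplied
    together, the quantity under the root in the derivative of \<open>arccos\<close>.\<close>
  have c1: "1 - c v = (1 - k) * (1 - cos v) / (1 + k * cos v)" for v
    using den[of v] by (simp add: c_def field_simps)
  have c2: "1 + c v = (1 + k) * (1 + cos v) / (1 + k * cos v)" for v
    using den[of v] by (simp add: c_def field_simps)
  have c_le: "- 1 \<le> c v" "c v \<le> 1" for v
  proof -
    have "0 \<le> 1 + cos v" using cos_ge_minus_one[of v] by linarith
    then have "0 \<le> 1 + c v" unfolding c2 using k den[of v]
      by (intro divide_nonneg_pos mult_nonneg_nonneg) auto
    then show "- 1 \<le> c v" by simp
    have "0 \<le> 1 - c v" unfolding c1 using k den[of v] cos_le_one[of v]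
      by (intro divide_nonneg_pos mult_nonneg_nonneg) auto
    then show "c v \<le> 1" by simp
  qed
  have E_ends: "E 0 = 0" "E pi = pi"
  proof -
    have "c 0 = 1" "c pi = - 1"
      using k by (simp_all add: c_def field_simps)
    then show "E 0 = 0" "E pi = pi" by (simp_all add: E_def)
  qed
  have sq: "1 - (c v)\<^sup>2 = (S * sin v / (1 + k * cos v))\<^sup>2" for v
  proof -
    have "1 - (c v)\<^sup>2 = (1 - c v) * (1 + c v)" by (simp add: power2_eq_square algebra_simps)
    also have "\<dots> = (1 - k\<^sup>2) * (1 - (cos v)\<^sup>2) / (1 + k * cos v)\<^sup>2"
      unfolding c1 c2 by (simp add: power2_eq_square algebra_simps)
    also have "\<dots> = (S * sin v / (1 + k * cos v))\<^sup>2"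
      unfolding S sin_squared_eq[symmetric] by (simp add: power_mult_distrib power_divide)
    finally show ?thesis .
  qed
  have dE: "(E has_real_derivative S / (1 + k * cos v)) (at v)" if v: "0 < v" "v < pi" for v
  proof -
    have sv: "0 < sin v" using v by (rule sin_gt_zero)
    then have pos: "0 < S * sin v / (1 + k * cos v)" using S den[of v] by simp
    have sqrt: "sqrt (1 - (c v)\<^sup>2) = S * sin v / (1 + k * cos v)"
      unfolding sq using pos by (simp only: real_sqrt_abs abs_of_pos)
    have "(c v)\<^sup>2 < 1" using sq[of v] zero_less_power[OF pos, of 2] by linarith
    then have "- 1 < c v" "c v < 1" by (simp_all add: abs_square_less_1 abs_less_iff)
    have "(c has_real_derivative
        ((- sin v) * (1 + k * cos v) - (k + cos v) * (k * - sin v)) / ((1 + k * cos v) * (1 + k * cos v))) (at v)"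
      unfolding c_def using den[of v] by (auto intro!: derivative_eq_intros)
    also have "((- sin v) * (1 + k * cos v) - (k + cos v) * (k * - sin v)) =
        - ((1 - k\<^sup>2) * sin v)"
      by (simp add: algebra_simps power2_eq_square)
    finally have "(c has_real_derivative - (S\<^sup>2 * sin v) / ((1 + k * cos v) * (1 + k * cos v))) (at v)"
      unfolding S .
    from DERIV_chain2[OF DERIV_arccos[OF \<open>- 1 < c v\<close> \<open>c v < 1\<close>] this]
    moreover have "inverse (- sqrt (1 - (c v)\<^sup>2)) * (- (S\<^sup>2 * sin v) / ((1 + k * cos v) * (1 + k * cos v))) =
        S / (1 + k * cos v)"
      unfolding sqrt using S(1) sv den[of v] by (simp add: divide_simps power2_eq_square)
    ultimately show ?thesis by (simp add: E_def[abs_def])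
  qed
  have contc: "continuous_on A c" for A
    unfolding c_def using den by (intro continuous_intros) (auto simp: less_imp_neq[THEN not_sym])
  have contE: "continuous_on A E" for A
    unfolding E_def using c_le by (intro continuous_on_arccos contc) auto
  let ?f = "\<lambda>t. 1 / hoyt_gamma g t q * exp (- (x / hoyt_gamma g t q))"
  have contf: "continuous_on A ?f" for A
    using hoyt_gamma_pos_nondegenerate[OF g q]
    by (intro continuous_intros continuous_hoyt_gamma) (auto simp: less_imp_neq[THEN not_sym])
  \<comment> \<open>\<open>arccos\<close> is not differentiable at -1 and 1, the values of
    \<open>c\<close> at the endpoints; the substitution rule used here asks only for continuity
    there.\<close>
  have "((\<lambda>v. (S / (1 + k * cos v)) *\<^sub>R ?f (E v)) has_integral integral {E 0..E pi} ?f) {0..pi}"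
  proof (rule has_integral_substitution_strong[where s = "{0, pi}" and c = 0 and d = pi])
    show "E ` {0..pi} \<subseteq> {0..pi}"
      using c_le by (auto simp: E_def intro!: arccos_lbound arccos_ubound)
    show "(E has_real_derivative S / (1 + k * cos v)) (at v within {0..pi})" if "v \<in> {0..pi} - {0, pi}" for v
      using that by (auto intro: has_field_derivative_at_within[OF dE])
  qed (use E_ends contf contE in simp_all)
  also have "(\<lambda>v. (S / (1 + k * cos v)) *\<^sub>R ?f (E v)) =
      (\<lambda>v. 1 / (g * S) * exp (- (x / (g * S\<^sup>2))) * exp (- (x * k / (g * S\<^sup>2)) * cos v))"
  proof
    fix v
    have "hoyt_gamma g (E v) q = g * (1 - k * c v)"
      using c_le by (simp add: hoyt_gamma_def E_def k_def)
    also have "1 - k * c v = (1 - k\<^sup>2) / (1 + k * cos v)"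
      using den[of v] by (simp add: c_def field_simps power2_eq_square)
    finally have G: "hoyt_gamma g (E v) q = g * S\<^sup>2 / (1 + k * cos v)" by (simp add: S)
    have "- (x / hoyt_gamma g (E v) q) = - (x / (g * S\<^sup>2)) + - (x * k / (g * S\<^sup>2)) * cos v"
      unfolding G using den[of v] S g by (simp add: field_simps)
    moreover have "S / D * (1 / (g * S\<^sup>2 / D)) = 1 / (g * S)" if "0 < D" for D
      using that S(1) g by (simp add: power2_eq_square)
    from this[OF den[of v]] have "S / (1 + k * cos v) * (1 / hoyt_gamma g (E v) q) = 1 / (g * S)"
      unfolding G .
    ultimately show "(S / (1 + k * cos v)) *\<^sub>R ?f (E v) =
        1 / (g * S) * exp (- (x / (g * S\<^sup>2))) * exp (- (x * k / (g * S\<^sup>2)) * cos v)"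
      by (simp only: exp_add real_scaleR_def mult.assoc[symmetric])
  qed
  finally have I: "((\<lambda>v. 1 / (g * S) * exp (- (x / (g * S\<^sup>2))) * exp (- (x * k / (g * S\<^sup>2)) * cos v))
      has_integral integral {0..pi} ?f) {0..pi}" by (simp add: E_ends)
  \<comment> \<open>The coefficient of \<open>cos v\<close> is negative; evenness of
    \<open>bessel_I0\<close> absorbs the sign in the comparison that follows.\<close>
  have "integral {0..pi} ?f =
      1 / (g * S) * exp (- (x / (g * S\<^sup>2))) * (pi * bessel_I0 (- (x * k / (g * S\<^sup>2))))"
    by (rule has_integral_unique[OF I has_integral_mult_right[OF has_integral_exp_cos]])
  also have "\<dots> = pi * squared_hoyt_pdf g q x"
  proof -
    have "x / (g * S\<^sup>2) = (1 + q\<^sup>2)\<^sup>2 * x / (4 * q\<^sup>2 * g)"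
      by (simp add: S_def power_divide power_mult_distrib mult_ac)
    moreover have "x * k / (g * S\<^sup>2) = (1 - q ^ 4) * x / (4 * q\<^sup>2 * g)"
    proof -
      have "(1 + q\<^sup>2)\<^sup>2 * k = 1 - q ^ 4"
      proof -
        have "(1 + q\<^sup>2) * k = 1 - q\<^sup>2" using q1 by (simp add: k_def)
        then have "(1 + q\<^sup>2)\<^sup>2 * k = (1 + q\<^sup>2) * (1 - q\<^sup>2)"
          by (simp only: power2_eq_square mult.assoc)
        then show ?thesis by (simp add: algebra_simps power4_eq_xxxx power2_eq_square)
      qed
      moreover have "x * k / (g * S\<^sup>2) = ((1 + q\<^sup>2)\<^sup>2 * k) * x / (4 * q\<^sup>2 * g)"
        by (simp add: S_def power_divide power_mult_distrib mult_ac)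
      ultimately show ?thesis by simp
    qed
    moreover have "1 / (g * S) = (1 + q\<^sup>2) / (2 * q * g)"
      by (simp add: S_def mult_ac)
    ultimately show ?thesis by (simp add: squared_hoyt_pdf_def)
  qed
  finally have "integral {0..pi} ?f = pi * squared_hoyt_pdf g q x" .
  then show ?thesis
    by (subst has_integral_iff) (intro conjI integrable_continuous_real contf)
qed

section \<open>Quadratic forms in Gaussian variables\<close>

text \<open>With \<open>s = tan (t / 2)\<close>, the factor \<open>2 / (1 + s\<^sup>2)\<close>
  cancels the Jacobian, and the half-angle formula for the cosine gives \<open>hoyt_gamma g t q = 2
  * (a * s\<^sup>2 + a * q\<^sup>2) / (1 + s\<^sup>2)\<close>. The left-hand side is the form in
  which the Gaussian tail arises.\<close>

lemma half_angle_integral: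
  assumes g: "0 < g" and q: "0 \<le> q" "q \<le> 1" and x: "0 \<le> x"
  defines "a \<equiv> g / (1 + q\<^sup>2)"
  shows "(\<integral>\<^sup>+s\<in>{0<..}. ennreal (2 / (1 + s\<^sup>2) * exp (- (x * (1 + s\<^sup>2) / (2 * (a * s\<^sup>2 + a * q\<^sup>2))))) \<partial>lborel)
    = ennreal (LBINT t:{0..pi}. exp (- (x / hoyt_gamma g t q)))"
proof -
  let ?f = "\<lambda>s. 2 / (1 + s\<^sup>2) * exp (- (x * (1 + s\<^sup>2) / (2 * (a * s\<^sup>2 + a * q\<^sup>2))))"
  let ?h = "\<lambda>t. exp (- (x / hoyt_gamma g t q))"
  let ?d = "\<lambda>t. inverse ((cos (t / 2))\<^sup>2) / 2"
  have q1: "1 + q\<^sup>2 > 0" by (simp add: add_pos_nonneg)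
  have a: "0 < a" using g q1 by (simp add: a_def)
  have s1: "0 < 1 + s\<^sup>2" for s :: real by (simp add: add_pos_nonneg)
  have cs: "0 < cos (t / 2)" "0 < sin (t / 2)" if "0 < t" "t < pi" for t
    using that by (auto intro!: cos_gt_zero_pi sin_gt_zero)
  have tan_pos: "0 < tan (t / 2)" if "0 < t" "t < pi" for t
    using that by (intro tan_gt_zero) auto
  have den: "0 < a * s\<^sup>2 + a * q\<^sup>2" if "0 < s" for s
    using a that by (intro add_pos_nonneg) auto
  have gam: "hoyt_gamma g t q = 2 * (a * (tan (t / 2))\<^sup>2 + a * q\<^sup>2) / (1 + (tan (t / 2))\<^sup>2)"
    if "0 < t" "t < pi" for t
  proof -
    have "cos (2 * (t / 2)) = (1 - (tan (t / 2))\<^sup>2) / (1 + (tan (t / 2))\<^sup>2)"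
      using cs[OF that] by (intro cos_tan_half) auto
    then have c: "cos t = (1 - (tan (t / 2))\<^sup>2) / (1 + (tan (t / 2))\<^sup>2)" by simp
    show ?thesis unfolding hoyt_gamma_def a_def c
      using q1 s1[of "tan (t / 2)"] by (simp add: divide_simps) (simp add: algebra_simps)
  qed
  have fh: "?f (tan (t / 2)) * ?d t = ?h t" if "0 < t" "t < pi" for t
  proof -
    have "1 + (tan (t / 2))\<^sup>2 = inverse ((cos (t / 2))\<^sup>2)"
      using tan_sec[of "t / 2"] cs[OF that] by (simp add: power_inverse)
    then have "2 / (1 + (tan (t / 2))\<^sup>2) * ?d t = 1"
      using cs[OF that] by simp
    moreover have "x * (1 + (tan (t / 2))\<^sup>2) / (2 * (a * (tan (t / 2))\<^sup>2 + a * q\<^sup>2)) = x / hoyt_gamma g t q"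
      unfolding gam[OF that] by simp
    moreover have "?f (tan (t / 2)) * ?d t = (2 / (1 + (tan (t / 2))\<^sup>2) * ?d t) *
        exp (- (x * (1 + (tan (t / 2))\<^sup>2) / (2 * (a * (tan (t / 2))\<^sup>2 + a * q\<^sup>2))))"
      by (simp only: mult_ac)
    ultimately show ?thesis by (simp only: mult_1_left)
  qed
  \<comment> \<open>Since \<open>x\<close> and the mean are nonnegative, the exponential is at most
    1, even where the mean is 0 and the quotient takes its default value 0.\<close>
  have ih: "set_integrable lborel {0..pi} ?h"
    unfolding set_integrable_def
    using hoyt_gamma_bounds[OF g q] x
    by (intro integrableI_bounded_set_indicator[where B = 1]) (auto simp: emeasure_lborel_Icc_eq)
  have ei: "einterval 0 pi = {0<..<pi}" "einterval 0 \<infinity> = {0<..}"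
    by (auto simp: einterval_def)
  have int: "set_integrable lborel (einterval 0 pi) (\<lambda>t. ?f (tan (t / 2)) * ?d t)"
  proof -
    have "set_integrable lborel {0<..<pi} ?h"
      by (rule set_integrable_subset[OF ih]) auto
    then show ?thesis unfolding ei
      by (subst set_integrable_cong[OF refl refl fh]) auto
  qed
  \<comment> \<open>The substitution rule works on an open interval with limits in the extended
    reals: the tangent of the half angle runs from 0 to infinity.\<close>
  have lim0: "((ereal \<circ> (\<lambda>t. tan (t / 2)) \<circ> real_of_ereal) \<longlongrightarrow> 0) (at_right 0)"
  proof -
    have "((\<lambda>t. tan (t / 2)) \<longlongrightarrow> tan (0 / 2)) (at_right 0)"
      by (intro tendsto_intros) auto
    then show ?thesis
      by (simp add: zero_ereal_def ereal_tendsto_simps)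
  qed
  have lim1: "((ereal \<circ> (\<lambda>t. tan (t / 2)) \<circ> real_of_ereal) \<longlongrightarrow> \<infinity>) (at_left (ereal pi))"
  proof -
    have "filterlim (\<lambda>t::real. t / 2) (at_left (pi / 2)) (at_left pi)"
      by (auto simp: filterlim_at eventually_at_filter intro!: tendsto_intros)
    from filterlim_compose[OF filterlim_tan_at_left this] show ?thesis
      by (simp add: ereal_tendsto_simps)
  qed
  have deriv: "((\<lambda>t. tan (t / 2)) has_real_derivative ?d t) (at t)"
    if "0 < ereal t" "ereal t < ereal pi" for t
    using cs[of t] that by (auto intro!: derivative_eq_intros simp: field_simps)
  have contf: "isCont ?f (tan (t / 2))" if "0 < ereal t" "ereal t < ereal pi" for t
    using den[OF tan_pos[of t]] s1[of "tan (t / 2)"] that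
    by (intro continuous_intros) auto
  have contd: "isCont ?d t" if "0 < ereal t" "ereal t < ereal pi" for t
    using cs[of t] that by (intro continuous_intros) auto
  have f_nonneg: "0 \<le> ?f s" for s using s1[of s] by (simp add: less_imp_le)
  have d_nonneg: "0 \<le> ?d t" for t :: real by simp
  note sub = interval_integral_substitution_nonneg[where f = ?f and g = "\<lambda>t. tan (t / 2)" and g' = ?d,
      OF _ deriv contf contd f_nonneg d_nonneg lim0 lim1 int]
  have s_int: "set_integrable lborel {0<..} ?f"
    using sub(1) unfolding ei by simp
  have "(LBINT s=0..\<infinity>. ?f s) = (LBINT t=0..pi. ?f (tan (t / 2)) * ?d t)"
    using sub(2) by simp
  then have "(LBINT s:{0<..}. ?f s) = (LBINT t:{0<..<pi}. ?f (tan (t / 2)) * ?d t)"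
    by (simp add: interval_lebesgue_integral_def ei)
  also have "\<dots> = (LBINT t:{0<..<pi}. ?h t)"
    by (rule set_lebesgue_integral_cong) (simp, intro allI impI fh, auto)
  also have "\<dots> = (LBINT t:{0..pi}. ?h t)"
    unfolding set_lebesgue_integral_def
  proof (rule integral_cong_AE)
    show "AE t in lborel. indicator {0<..<pi} t *\<^sub>R ?h t = indicator {0..pi} t *\<^sub>R ?h t"
      using AE_lborel_singleton[of 0] AE_lborel_singleton[of pi]
      by eventually_elim (auto split: split_indicator)
  qed measurable
  finally have "(LBINT s:{0<..}. ?f s) = (LBINT t:{0..pi}. ?h t)" .
  moreover have "(\<integral>\<^sup>+s\<in>{0<..}. ennreal (?f s) \<partial>lborel) = ennreal (LBINT s:{0<..}. ?f s)"
  proof -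
    have "(\<integral>\<^sup>+s. ennreal (indicator {0<..} s *\<^sub>R ?f s) \<partial>lborel) = ennreal (LBINT s:{0<..}. ?f s)"
      unfolding set_lebesgue_integral_def
      by (rule nn_integral_eq_integral[OF s_int[unfolded set_integrable_def]])
        (intro AE_I2 scaleR_nonneg_nonneg f_nonneg indicator_pos_le)
    moreover have "ennreal (indicator {0<..} s *\<^sub>R ?f s) = ennreal (?f s) * indicator {0<..} s" for s
      by (simp split: split_indicator)
    ultimately show ?thesis by (simp only:)
  qed
  ultimately show ?thesis by simp
qed

lemma nn_integral_even_function:
  fixes h :: "real \<Rightarrow> ennreal"
  assumes [measurable]: "h \<in> borel_measurable borel" and even: "\<And>x. h (- x) = h x"
  shows "(\<integral>\<^sup>+x. h x \<partial>lborel) = 2 * (\<integral>\<^sup>+x\<in>{0<..}. h x \<partial>lborel)"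
proof -
  have neg: "(\<integral>\<^sup>+x\<in>{..<0}. h x \<partial>lborel) = (\<integral>\<^sup>+x\<in>{0<..}. h x \<partial>lborel)"
    by (subst nn_integral_real_affine[where c = "-1" and t = 0])
      (auto simp: even intro!: nn_integral_cong split: split_indicator)
  have "(\<integral>\<^sup>+x. h x \<partial>lborel) =
      (\<integral>\<^sup>+x. h x * indicator {0<..} x + h x * indicator {..<0} x \<partial>lborel)"
    using AE_lborel_singleton[of 0]
    by (intro nn_integral_cong_AE) (auto elim!: eventually_mono split: split_indicator)
  also have "\<dots> = 2 * (\<integral>\<^sup>+x\<in>{0<..}. h x \<partial>lborel)"
    by (subst nn_integral_add) (auto simp: neg mult_2)
  finally show ?thesis .
qed

text \<open>Evenness reduces the plane to the quadrant of positive \<open>u\<close> and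
  \<open>v\<close>, where \<open>u = v * s\<close> has Jacobian \<open>v\<close>. For fixed
  \<open>s\<close> both the Gaussian exponent and the quadratic form are multiples of
  \<open>v\<^sup>2\<close>, so the integral over \<open>v\<close> is elementary. Admitting
  \<open>b = 0\<close> covers the degenerate second variable.\<close>

lemma gaussian_quadratic_form_tail:
  fixes a b x :: real
  assumes a: "0 < a" and b: "0 \<le> b" and x: "0 \<le> x"
  defines "G \<equiv> density lborel (\<lambda>x. ennreal (std_normal_density x))"
  shows "emeasure (G \<Otimes>\<^sub>M G) {\<omega>. x < a * (snd \<omega>)\<^sup>2 + b * (fst \<omega>)\<^sup>2} =
    ennreal (1 / pi) * (\<integral>\<^sup>+s\<in>{0<..}. ennreal (2 / (1 + s\<^sup>2) *
      exp (- (x * (1 + s\<^sup>2) / (2 * (a * s\<^sup>2 + b))))) \<partial>lborel)"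
proof -
  interpret G: prob_space G
    unfolding G_def by (rule prob_space_normal_density) simp
  have [measurable_cong]: "sets G = sets borel" by (simp add: G_def)
  \<comment> \<open>\<open>H\<close> is the joint density without its constant
    \<open>1 / (2 * pi)\<close>, cut off to the tail event. Here \<open>u\<close> is the second
    coordinate of the pair and \<open>v\<close> the first.\<close>
  define H where "H u v = ennreal (exp (- (u\<^sup>2 + v\<^sup>2) / 2)) *
      indicator {p. x < a * (fst p)\<^sup>2 + b * (snd p)\<^sup>2} (u, v)" for u v :: real
  have [measurable]: "(\<lambda>p. H (fst p) (snd p)) \<in> borel_measurable (borel \<Otimes>\<^sub>M borel)"
    unfolding H_def by measurable
  have [measurable]: "(\<lambda>p. H (f p) (h p)) \<in> borel_measurable N"
    if [measurable]: "f \<in> borel_measurable N" "h \<in> borel_measurable N" for f h :: "'x \<Rightarrow> real" and N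
  proof -
    have "(\<lambda>p. (\<lambda>p. H (fst p) (snd p)) (f p, h p)) \<in> borel_measurable N" by measurable
    then show ?thesis by simp
  qed
  have even: "H (- u) v = H u v" "H u (- v) = H u v" for u v
    by (simp_all add: H_def indicator_def)
  have inner: "(\<integral>\<^sup>+v\<in>{0<..}. ennreal v * H (v * s) v \<partial>lborel) =
      ennreal (1 / 2) * ennreal (2 / (1 + s\<^sup>2) * exp (- (x * (1 + s\<^sup>2) / (2 * (a * s\<^sup>2 + b)))))"
    if s: "0 < s" for s
  proof -
    \<comment> \<open>On the ray \<open>u = v * s\<close> one has
      \<open>u\<^sup>2 + v\<^sup>2 = m * v\<^sup>2\<close> and the form equals
      \<open>c * v\<^sup>2\<close>, so the tail event consists of the \<open>v\<close> beyond
      \<open>v0\<close>.\<close>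
    define m where "m = 1 + s\<^sup>2"
    define c where "c = a * s\<^sup>2 + b"
    define v0 where "v0 = sqrt (x / c)"
    have m: "0 < m" by (simp add: m_def add_pos_nonneg)
    have c: "0 < c" using a b s by (simp add: c_def add_pos_nonneg)
    have v0: "0 \<le> v0" "v0\<^sup>2 = x / c" using x c by (auto simp: v0_def)
    have iff: "x < a * (v * s)\<^sup>2 + b * v\<^sup>2 \<longleftrightarrow> v0 < v" if "0 < v" for v
    proof -
      have "x < a * (v * s)\<^sup>2 + b * v\<^sup>2 \<longleftrightarrow> x < c * v\<^sup>2"
        by (simp add: c_def power_mult_distrib algebra_simps)
      also have "\<dots> \<longleftrightarrow> v0\<^sup>2 < v\<^sup>2" unfolding v0 using c by (simp add: field_simps)
      also have "\<dots> \<longleftrightarrow> v0 < v"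
        using that v0 by (metis less_imp_le power2_less_imp_less power_strict_mono zero_less_numeral)
      finally show ?thesis .
    qed
    have "(\<integral>\<^sup>+v\<in>{0<..}. ennreal v * H (v * s) v \<partial>lborel) =
        (\<integral>\<^sup>+v. ennreal (v * exp (- (m * v\<^sup>2) / 2)) * indicator {v0..} v \<partial>lborel)"
    proof (rule nn_integral_cong_AE)
      \<comment> \<open>The strict tail event and the closed half-line of the integration rule can
        disagree at \<open>v0\<close>, a null set.\<close>
      have "ennreal v * H (v * s) v * indicator {0<..} v =
          ennreal (v * exp (- (m * v\<^sup>2) / 2)) * indicator {v0..} v" if "v \<noteq> v0" for v
      proof -
        consider "v \<le> 0" | "0 < v" "v < v0" | "0 < v" "v0 < v" using \<open>v \<noteq> v0\<close> by linarith
        then show ?thesis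
        proof cases
          case 1
          then show ?thesis using v0(1) that by (auto split: split_indicator)
        next
          case 2
          then show ?thesis using iff[of v] by (simp add: H_def)
        next
          case 3
          then have "(v * s)\<^sup>2 + v\<^sup>2 = m * v\<^sup>2" by (simp add: m_def power_mult_distrib algebra_simps)
          then show ?thesis using iff[of v] 3 v0(1)
            by (simp add: H_def ennreal_mult[symmetric])
        qed
      qed
      then show "AE v in lborel. ennreal v * H (v * s) v * indicator {0<..} v =
          ennreal (v * exp (- (m * v\<^sup>2) / 2)) * indicator {v0..} v"
        using AE_lborel_singleton[of v0] by (auto elim!: eventually_mono)
    qed
    also have "\<dots> = ennreal (0 - - exp (- (m * v0\<^sup>2) / 2) / m)"
    proof (rule nn_integral_FTC_atLeast)
      show "((\<lambda>v. - exp (- (m * v\<^sup>2) / 2) / m) has_real_derivative v * exp (- (m * v\<^sup>2) / 2)) (at v)" for v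
        using m by (auto intro!: derivative_eq_intros simp: field_simps)
      have "filterlim (\<lambda>v. m / 2 * v\<^sup>2) at_top at_top"
        using m by (intro filterlim_tendsto_pos_mult_at_top[OF tendsto_const]
          filterlim_pow_at_top filterlim_ident) auto
      then have "filterlim (\<lambda>v. - (m * v\<^sup>2) / 2) at_bot at_top"
        by (simp add: filterlim_uminus_at_bot)
      from tendsto_divide[OF tendsto_minus[OF filterlim_compose[OF exp_at_bot this]] tendsto_const[of m]]
      show "((\<lambda>v. - exp (- (m * v\<^sup>2) / 2) / m) \<longlongrightarrow> 0) at_top" using m by simp
    qed (use v0 in auto)
    also have "0 - - exp (- (m * v0\<^sup>2) / 2) / m = 1 / 2 * (2 / m * exp (- (x * m / (2 * c))))"
      unfolding v0 by (simp add: mult_ac)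
    also have "ennreal \<dots> = ennreal (1 / 2) * ennreal (2 / m * exp (- (x * m / (2 * c))))"
      using m by (intro ennreal_mult) auto
    finally show ?thesis unfolding m_def c_def .
  qed
  have "{\<omega> \<in> space (borel \<Otimes>\<^sub>M borel). x < a * (snd \<omega>)\<^sup>2 + b * (fst \<omega>)\<^sup>2} \<in> sets (borel \<Otimes>\<^sub>M borel)"
    by measurable
  then have [measurable]: "{\<omega>. x < a * (snd \<omega>)\<^sup>2 + b * (fst \<omega>)\<^sup>2} \<in> sets (borel \<Otimes>\<^sub>M borel)"
    by (simp add: space_pair_measure)
  have "emeasure (G \<Otimes>\<^sub>M G) {\<omega>. x < a * (snd \<omega>)\<^sup>2 + b * (fst \<omega>)\<^sup>2} =
      (\<integral>\<^sup>+v. \<integral>\<^sup>+u. indicator {\<omega>. x < a * (snd \<omega>)\<^sup>2 + b * (fst \<omega>)\<^sup>2} (v, u) \<partial>G \<partial>G)"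
    by (rule G.emeasure_pair_measure) measurable
  also have "\<dots> = (\<integral>\<^sup>+v. ennreal (std_normal_density v) * (\<integral>\<^sup>+u. ennreal (std_normal_density u) *
      indicator {\<omega>. x < a * (snd \<omega>)\<^sup>2 + b * (fst \<omega>)\<^sup>2} (v, u) \<partial>lborel) \<partial>lborel)"
    unfolding G_def by (simp add: nn_integral_density)
  also have "\<dots> = (\<integral>\<^sup>+v. \<integral>\<^sup>+u. ennreal (1 / (2 * pi)) * H u v \<partial>lborel \<partial>lborel)"
  proof (intro nn_integral_cong)
    fix v :: real
    have dens: "std_normal_density v * std_normal_density u = 1 / (2 * pi) * exp (- (u\<^sup>2 + v\<^sup>2) / 2)" for u
      by (simp add: std_normal_density_def exp_add[symmetric] field_simps)
    show "ennreal (std_normal_density v) * (\<integral>\<^sup>+u. ennreal (std_normal_density u) *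
        indicator {\<omega>. x < a * (snd \<omega>)\<^sup>2 + b * (fst \<omega>)\<^sup>2} (v, u) \<partial>lborel) =
        (\<integral>\<^sup>+u. ennreal (1 / (2 * pi)) * H u v \<partial>lborel)"
    proof (subst nn_integral_cmult[symmetric], measurable, intro nn_integral_cong)
      fix u
      have "ennreal (std_normal_density v) * ennreal (std_normal_density u) =
          ennreal (1 / (2 * pi)) * ennreal (exp (- (u\<^sup>2 + v\<^sup>2) / 2))"
        by (simp only: ennreal_mult[symmetric] dens normal_density_nonneg exp_ge_zero
            divide_nonneg_nonneg zero_le_one pi_ge_zero mult_nonneg_nonneg zero_le_numeral)
      then show "ennreal (std_normal_density v) * (ennreal (std_normal_density u) *
          indicator {\<omega>. x < a * (snd \<omega>)\<^sup>2 + b * (fst \<omega>)\<^sup>2} (v, u)) = ennreal (1 / (2 * pi)) * H u v"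
        by (simp add: H_def mult.assoc[symmetric] split: split_indicator)
    qed
  qed
  also have "\<dots> = ennreal (1 / (2 * pi)) * (\<integral>\<^sup>+v. \<integral>\<^sup>+u. H u v \<partial>lborel \<partial>lborel)"
    by (simp add: nn_integral_cmult)
  also have "(\<integral>\<^sup>+v. \<integral>\<^sup>+u. H u v \<partial>lborel \<partial>lborel) =
      2 * (\<integral>\<^sup>+v\<in>{0<..}. (\<integral>\<^sup>+u. H u v \<partial>lborel) \<partial>lborel)"
    by (rule nn_integral_even_function) (simp_all add: even)
  \<comment> \<open>For each \<open>v > 0\<close> the variable \<open>u\<close> is rescaled to
    \<open>v * s\<close>; the inner factor 2 comes from evenness in \<open>s\<close>.\<close>
  also have "\<dots> = 2 * (\<integral>\<^sup>+v. (\<integral>\<^sup>+s. 2 * (ennreal v * H (v * s) v * indicator {0<..} v * indicator {0<..} s) \<partial>lborel) \<partial>lborel)"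
  proof (intro arg_cong[where f = "\<lambda>y. 2 * y"] nn_integral_cong)
    fix v :: real
    show "(\<integral>\<^sup>+u. H u v \<partial>lborel) * indicator {0<..} v =
        (\<integral>\<^sup>+s. 2 * (ennreal v * H (v * s) v * indicator {0<..} v * indicator {0<..} s) \<partial>lborel)"
    proof (cases "0 < v")
      case True
      have "(\<integral>\<^sup>+u. H u v \<partial>lborel) = ennreal \<bar>v\<bar> * (\<integral>\<^sup>+s. H (0 + v * s) v \<partial>lborel)"
        using True by (intro nn_integral_real_affine) auto
      also have "(\<integral>\<^sup>+s. H (0 + v * s) v \<partial>lborel) = 2 * (\<integral>\<^sup>+s\<in>{0<..}. H (0 + v * s) v \<partial>lborel)"
        by (rule nn_integral_even_function) (simp_all add: even)
      finally show ?thesis using True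
        by (simp add: nn_integral_cmult[symmetric] mult_ac)
    qed simp
  qed
  also have "(\<integral>\<^sup>+v. (\<integral>\<^sup>+s. 2 * (ennreal v * H (v * s) v * indicator {0<..} v * indicator {0<..} s) \<partial>lborel) \<partial>lborel) =
      (\<integral>\<^sup>+s. (\<integral>\<^sup>+v. 2 * (ennreal v * H (v * s) v * indicator {0<..} v * indicator {0<..} s) \<partial>lborel) \<partial>lborel)"
    by (rule lborel_pair.Fubini') measurable
  also have "\<dots> = (\<integral>\<^sup>+s. ennreal (2 / (1 + s\<^sup>2) * exp (- (x * (1 + s\<^sup>2) / (2 * (a * s\<^sup>2 + b)))))
      * indicator {0<..} s \<partial>lborel)"
  proof (intro nn_integral_cong)
    fix s :: real
    let ?F = "ennreal (2 / (1 + s\<^sup>2) * exp (- (x * (1 + s\<^sup>2) / (2 * (a * s\<^sup>2 + b)))))"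
    \<comment> \<open>The 1/2 of the radial integral cancels the factor 2 from evenness in
      \<open>s\<close>; the factor 2 from evenness in \<open>v\<close> will turn
      \<open>1 / (2 * pi)\<close> into \<open>1 / pi\<close>.\<close>
    have half: "2 * (ennreal (1 / 2) * y) = y" for y
      unfolding mult.assoc[symmetric] ennreal_numeral[symmetric]
      by (subst ennreal_mult[symmetric]) simp_all
    have half': "2 * (inverse 2 * y) = y" for y :: ennreal
      using half[of y] by simp
    show "(\<integral>\<^sup>+v. 2 * (ennreal v * H (v * s) v * indicator {0<..} v * indicator {0<..} s) \<partial>lborel) =
        ?F * indicator {0<..} s"
      using inner[of s] by (cases "0 < s") (simp_all add: nn_integral_cmult half')
  qed
  finally have "emeasure (G \<Otimes>\<^sub>M G) {\<omega>. x < a * (snd \<omega>)\<^sup>2 + b * (fst \<omega>)\<^sup>2} =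
      (ennreal (1 / (2 * pi)) * 2) * (\<integral>\<^sup>+s\<in>{0<..}. ennreal (2 / (1 + s\<^sup>2) *
      exp (- (x * (1 + s\<^sup>2) / (2 * (a * s\<^sup>2 + b))))) \<partial>lborel)"
    by (simp only: mult.assoc)
  also have "ennreal (1 / (2 * pi)) * 2 = ennreal (1 / pi)"
    unfolding ennreal_numeral[symmetric] by (subst ennreal_mult[symmetric]) simp_all
  finally show ?thesis .
qed

section \<open>Realization of the law by independent Gaussian coordinates\<close>

lemma distr_std_normal_scale:
  assumes "0 \<le> s"
  shows "distr (density lborel (\<lambda>x. ennreal (std_normal_density x))) borel (\<lambda>v. s * v) = centered_gaussian s"
proof -
  let ?G = "density lborel (\<lambda>x. ennreal (std_normal_density x))"
  interpret G: prob_space ?G by (rule prob_space_normal_density) simp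
  show ?thesis
  proof (cases "s = 0")
    case True
    then show ?thesis by (simp add: centered_gaussian_def)
  next
    case False
    with assms have s: "0 < s" by simp
    have "distributed ?G lborel (\<lambda>v. v) (\<lambda>x. ennreal (std_normal_density x))"
      by (auto simp: distributed_def intro!: measure_eqI simp: emeasure_distr)
    from G.normal_density_affine[OF this zero_less_one, of s 0] s
    have "distributed ?G lborel (\<lambda>v. s * v) (\<lambda>x. ennreal (normal_density 0 s x))" by simp
    then have "distr ?G lborel (\<lambda>v. s * v) = density lborel (\<lambda>x. ennreal (normal_density 0 s x))"
      by (simp add: distributed_def)
    moreover have "distr ?G lborel (\<lambda>v. s * v) = distr ?G borel (\<lambda>v. s * v)"
      by (intro distr_cong) auto
    ultimately show ?thesis using False by (simp add: centered_gaussian_def)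
  qed
qed

text \<open>A cdf determines its law, so one Gaussian pair with the same cdf suffices. The pair
  consists of two independent standard normal coordinates, scaled by \<open>\<sigma>\<close> and
  \<open>q * \<sigma>\<close>.\<close>

lemma squared_hoyt_of_cdf:
  assumes g: "0 < g" and q: "0 \<le> q" "q \<le> 1" and D: "real_distribution D"
    and cdf: "\<And>x. 0 \<le> x \<Longrightarrow> cdf D x = 1 - 1 / pi * (LBINT t:{0..pi}. exp (- (x / hoyt_gamma g t q)))"
  shows "squared_hoyt g q D"
proof -
  interpret D: real_distribution D by fact
  \<comment> \<open>The mean of the sum of squares is
    \<open>\<sigma>\<^sup>2 * (1 + q\<^sup>2)\<close>; equating it to \<open>g\<close> forces
    \<open>\<sigma>\<^sup>2 = a\<close>.\<close>
  define a where "a = g / (1 + q\<^sup>2)"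
  define \<sigma> where "\<sigma> = sqrt a"
  have q1: "0 < 1 + q\<^sup>2" by (simp add: add_pos_nonneg)
  have a: "0 < a" using g q1 by (simp add: a_def)
  have \<sigma>: "0 < \<sigma>" "\<sigma>\<^sup>2 = a" using a by (simp_all add: \<sigma>_def)
  define G where "G = density lborel (\<lambda>x. ennreal (std_normal_density x))"
  interpret G: prob_space G unfolding G_def by (rule prob_space_normal_density) simp
  interpret N: pair_prob_space G G ..
  have [measurable_cong]: "sets G = sets borel" by (simp add: G_def)
  have fst: "distr (G \<Otimes>\<^sub>M G) borel fst = G"
  proof -
    have "distr (G \<Otimes>\<^sub>M G) borel fst = distr (G \<Otimes>\<^sub>M G) G fst"
      by (intro distr_cong) (auto simp: G_def)
    then show ?thesis by (simp add: G.distr_pair_fst)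
  qed
  \<comment> \<open>The variable with the larger variance is the second coordinate, as in the tail
    formula. Invariance of the product under the swap supplies its law and the independence in this
    order.\<close>
  have swap: "distr (G \<Otimes>\<^sub>M G) (G \<Otimes>\<^sub>M G) (\<lambda>(x, y). (y, x)) = G \<Otimes>\<^sub>M G"
    by (rule N.distr_pair_swap[symmetric])
  have snd: "distr (G \<Otimes>\<^sub>M G) borel snd = G"
  proof -
    have "distr (G \<Otimes>\<^sub>M G) borel snd = distr (distr (G \<Otimes>\<^sub>M G) (G \<Otimes>\<^sub>M G) (\<lambda>(x, y). (y, x))) borel snd"
      by (simp only: swap)
    also have "\<dots> = distr (G \<Otimes>\<^sub>M G) borel fst"
      by (subst distr_distr) (auto simp: comp_def split_beta)
    finally show ?thesis by (simp add: fst)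
  qed
  have "N.indep_var borel snd borel fst"
    unfolding N.indep_var_distribution_eq fst snd
  proof (intro conjI)
    have "distr (G \<Otimes>\<^sub>M G) (borel \<Otimes>\<^sub>M borel) (\<lambda>x. (snd x, fst x)) =
        distr (G \<Otimes>\<^sub>M G) (G \<Otimes>\<^sub>M G) (\<lambda>(x, y). (y, x))"
      by (intro distr_cong sets_pair_measure_cong) (auto simp: G_def)
    then show "G \<Otimes>\<^sub>M G = distr (G \<Otimes>\<^sub>M G) (borel \<Otimes>\<^sub>M borel) (\<lambda>x. (snd x, fst x))"
      by (simp add: swap)
  qed measurable
  from N.indep_var_compose[OF this, of "\<lambda>v. \<sigma> * v" borel "\<lambda>v. q * \<sigma> * v" borel]
  have indep: "N.indep_var borel (\<lambda>\<omega>. \<sigma> * snd \<omega>) borel (\<lambda>\<omega>. q * \<sigma> * fst \<omega>)"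
    by (simp add: comp_def)
  have dX: "distr (G \<Otimes>\<^sub>M G) borel (\<lambda>\<omega>. \<sigma> * snd \<omega>) = centered_gaussian \<sigma>"
  proof -
    have "distr (G \<Otimes>\<^sub>M G) borel (\<lambda>\<omega>. \<sigma> * snd \<omega>) = distr (distr (G \<Otimes>\<^sub>M G) borel snd) borel (\<lambda>v. \<sigma> * v)"
      by (subst distr_distr) (auto simp: comp_def)
    then show ?thesis unfolding snd unfolding G_def using \<sigma> by (simp add: distr_std_normal_scale)
  qed
  have dY: "distr (G \<Otimes>\<^sub>M G) borel (\<lambda>\<omega>. q * \<sigma> * fst \<omega>) = centered_gaussian (q * \<sigma>)"
  proof -
    have "distr (G \<Otimes>\<^sub>M G) borel (\<lambda>\<omega>. q * \<sigma> * fst \<omega>) = distr (distr (G \<Otimes>\<^sub>M G) borel fst) borel (\<lambda>v. q * \<sigma> * v)"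
      by (subst distr_distr) (auto simp: comp_def)
    then show ?thesis unfolding fst unfolding G_def using \<sigma> q by (simp add: distr_std_normal_scale)
  qed
  have form: "(\<sigma> * snd \<omega>)\<^sup>2 + (q * \<sigma> * fst \<omega>)\<^sup>2 = a * (snd \<omega>)\<^sup>2 + a * q\<^sup>2 * (fst \<omega>)\<^sup>2" for \<omega> :: "real \<times> real"
    unfolding power_mult_distrib \<sigma> by simp
  have sq: "has_bochner_integral G (\<lambda>v. v\<^sup>2) 1"
    unfolding G_def using std_normal_moment_even[of 1]
    by (intro has_bochner_integral_density) auto
  have sq1: "has_bochner_integral (G \<Otimes>\<^sub>M G) (\<lambda>\<omega>. (fst \<omega>)\<^sup>2) 1"
    using sq by (subst (asm) fst[symmetric])
      (auto simp: has_bochner_integral_iff integrable_distr_eq integral_distr)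
  have sq2: "has_bochner_integral (G \<Otimes>\<^sub>M G) (\<lambda>\<omega>. (snd \<omega>)\<^sup>2) 1"
    using sq by (subst (asm) snd[symmetric])
      (auto simp: has_bochner_integral_iff integrable_distr_eq integral_distr)
  have "has_bochner_integral (G \<Otimes>\<^sub>M G) (\<lambda>\<omega>. a * (snd \<omega>)\<^sup>2 + a * q\<^sup>2 * (fst \<omega>)\<^sup>2) (a * 1 + a * q\<^sup>2 * 1)"
    by (intro has_bochner_integral_add has_bochner_integral_mult_right sq1 sq2)
  then have "(\<integral>\<omega>. a * (snd \<omega>)\<^sup>2 + a * q\<^sup>2 * (fst \<omega>)\<^sup>2 \<partial>(G \<Otimes>\<^sub>M G)) = a * (1 + q\<^sup>2)"
    by (simp add: has_bochner_integral_iff algebra_simps)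
  then have mean: "g = (\<integral>\<omega>. (\<sigma> * snd \<omega>)\<^sup>2 + (q * \<sigma> * fst \<omega>)\<^sup>2 \<partial>(G \<Otimes>\<^sub>M G))"
    unfolding form using q1 by (simp add: a_def)
  define L where "L = distr (G \<Otimes>\<^sub>M G) borel (\<lambda>\<omega>. (\<sigma> * snd \<omega>)\<^sup>2 + (q * \<sigma> * fst \<omega>)\<^sup>2)"
  interpret L: real_distribution L unfolding L_def by simp
  have L: "cdf L x = 1 - 1 / pi * (LBINT t:{0..pi}. exp (- (x / hoyt_gamma g t q)))" if x: "0 \<le> x" for x
  proof -
    let ?I = "LBINT t:{0..pi}. exp (- (x / hoyt_gamma g t q))"
    have "emeasure L {x<..} = emeasure (G \<Otimes>\<^sub>M G) {\<omega>. x < a * (snd \<omega>)\<^sup>2 + a * q\<^sup>2 * (fst \<omega>)\<^sup>2}"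
      unfolding L_def form
      by (subst emeasure_distr) (auto simp: space_pair_measure G_def intro!: arg_cong2[where f = emeasure])
    also have "\<dots> = ennreal (1 / pi) * ennreal ?I"
      unfolding half_angle_integral[OF g q x, symmetric] a_def[symmetric] unfolding G_def
      using a x by (intro gaussian_quadratic_form_tail) auto
    also have "\<dots> = ennreal (1 / pi * ?I)"
      by (intro ennreal_mult[symmetric]) (auto simp: set_lebesgue_integral_def)
    finally have "measure L {x<..} = 1 / pi * ?I"
      by (intro measure_eq_emeasure_eq_ennreal) (auto simp: set_lebesgue_integral_def)
    moreover have "measure L {..x} = 1 - measure L {x<..}"
      using L.prob_compl[of "{x<..}"] by (simp add: Compl_eq_Diff_UNIV[symmetric])
    ultimately show ?thesis by (simp add: cdf_def2)
  qed
  have "D = L"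
  proof (rule cdf_unique[OF D L.real_distribution_axioms], rule ext)
    fix x
    show "cdf D x = cdf L x"
    proof (cases "0 \<le> x")
      case True
      then show ?thesis by (simp add: cdf L)
    next
      case False
      \<comment> \<open>At 0 every exponential is 1, so both cdfs vanish there; monotonicity and
        nonnegativity make them vanish to the left as well.\<close>
      have "cdf L 0 = 0"
        by (simp add: L set_lebesgue_integral_def)
      moreover have "cdf D 0 = 0" unfolding cdf[OF order_refl] L[OF order_refl, symmetric] by fact
      ultimately show ?thesis
        using D.cdf_nondecreasing[of x 0] L.cdf_nondecreasing[of x 0] False
          D.cdf_nonneg[of x] L.cdf_nonneg[of x] by simp
    qed
  qed
  show ?thesis unfolding squared_hoyt_def
  proof (intro exI conjI)
    show "prob_space (G \<Otimes>\<^sub>M G)" by (rule N.prob_space_axioms)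
    show "D = distr (G \<Otimes>\<^sub>M G) borel (\<lambda>\<omega>. (\<sigma> * snd \<omega>)\<^sup>2 + (q * \<sigma> * fst \<omega>)\<^sup>2)"
      using \<open>D = L\<close> by (simp add: L_def)
    show "q * \<sigma> \<le> \<sigma>" "0 \<le> q * \<sigma>" "q = q * \<sigma> / \<sigma>" using q \<sigma> by (auto simp: mult_left_le_one_le)
  qed fact+
qed

section \<open>Mixtures of exponential densities\<close>

lemma nn_integral_uniform_0_pi:
  assumes [measurable]: "h \<in> borel_measurable borel" and "\<And>t. 0 \<le> h t"
    and "set_integrable lborel {0..pi} h"
  shows "(\<integral>\<^sup>+t. ennreal (h t) \<partial>uniform_measure lborel {0..pi}) = ennreal (1 / pi * (LBINT t:{0..pi}. h t))"
proof -
  have "(\<integral>\<^sup>+t. ennreal (h t) * indicator {0..pi} t \<partial>lborel) = (\<integral>\<^sup>+t. ennreal (indicator {0..pi} t *\<^sub>R h t) \<partial>lborel)"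
    by (intro nn_integral_cong) (simp split: split_indicator)
  also have "\<dots> = ennreal (LBINT t:{0..pi}. h t)"
    unfolding set_lebesgue_integral_def
    using assms by (intro nn_integral_eq_integral) (auto simp: set_integrable_def)
  finally have "(\<integral>\<^sup>+t. ennreal (h t) \<partial>uniform_measure lborel {0..pi}) =
      ennreal (LBINT t:{0..pi}. h t) / ennreal pi"
    by (simp add: nn_integral_uniform_measure)
  also have "\<dots> = ennreal (1 / pi * (LBINT t:{0..pi}. h t))"
    using assms by (subst divide_ennreal) (auto simp: set_lebesgue_integral_def intro!: integral_nonneg)
  finally show ?thesis .
qed

lemma set_integrable_bounded_0_pi:
  fixes h :: "real \<Rightarrow> real"
  assumes "h \<in> borel_measurable borel" "\<And>t. \<bar>h t\<bar> \<le> B"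
  shows "set_integrable lborel {0..pi} h"
  unfolding set_integrable_def
  using assms by (intro integrableI_bounded_set_indicator[where B = B]) (auto simp: emeasure_lborel_Icc_eq)

text \<open>Three test functions against an exponential law, serving in turn the conditional mean,
  the nonnegativity of \<open>R\<close>, and the cdf.\<close>

lemma nn_integral_exponential:
  assumes l: "0 < l"
  shows "(\<integral>\<^sup>+x. ennreal x * ennreal (exponential_density l x) \<partial>lborel) = ennreal (1 / l)"
    and "(\<integral>\<^sup>+x. indicator {..<0} x * ennreal (exponential_density l x) \<partial>lborel) = 0"
    and "0 \<le> a \<Longrightarrow> (\<integral>\<^sup>+x. indicator {a<..} x * ennreal (exponential_density l x) \<partial>lborel) = ennreal (exp (- (a * l)))"
proof -
  have "ennreal x * ennreal (exponential_density l x) = ennreal (exponential_density l x * x ^ 1)" for x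
    using l by (cases "0 \<le> x") (auto simp: ennreal_mult[symmetric] exponential_density_def ennreal_neg mult.commute)
  then show "(\<integral>\<^sup>+x. ennreal x * ennreal (exponential_density l x) \<partial>lborel) = ennreal (1 / l)"
    using nn_integral_erlang_ith_moment[OF l, of 0 1] l
    by (simp add: divide_ennreal[symmetric])
  show "(\<integral>\<^sup>+x. indicator {..<0} x * ennreal (exponential_density l x) \<partial>lborel) = 0"
    by (intro nn_integral_zero') (auto simp: exponential_density_def split: split_indicator)
next
  assume a: "0 \<le> a"
  let ?E = "density lborel (\<lambda>x. ennreal (exponential_density l x))"
  interpret E: prob_space ?E by (rule prob_space_exponential_density[OF l])
  have "distributed ?E lborel (\<lambda>x. x) (\<lambda>x. ennreal (exponential_density l x))"
    by (auto simp: distributed_def intro!: measure_eqI simp: emeasure_distr)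
  from E.exponential_distributedD_gt[OF this a l]
  have "measure ?E {a<..} = exp (- a * l)" by (simp add: greaterThan_def)
  then have "emeasure ?E {a<..} = ennreal (exp (- (a * l)))"
    by (simp add: E.emeasure_eq_measure)
  then show "(\<integral>\<^sup>+x. indicator {a<..} x * ennreal (exponential_density l x) \<partial>lborel) = ennreal (exp (- (a * l)))"
    by (simp add: emeasure_density mult.commute)
qed

text \<open>This is \<open>y * exp (- y) \<le> 1\<close> at \<open>y = x / u\<close>. The bound is
  uniform in \<open>u\<close>, so it dominates the mixture integrand even where the mean tends to 0;
  at \<open>u = 0\<close> division gives the default value 0.\<close>

lemma inverse_exp_le:
  fixes u x :: real
  assumes "0 < x" "0 \<le> u"
  shows "1 / u * exp (- (x / u)) \<le> 1 / x"
proof (cases "u = 0")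
  case False
  with assms have "0 < x / u" by simp
  have "y * exp (- y) \<le> 1" for y :: real
  proof -
    have "y \<le> exp y" using exp_ge_add_one_self[of y] by linarith
    then show ?thesis by (simp add: exp_minus divide_inverse[symmetric])
  qed
  then have "x / u * exp (- (x / u)) \<le> 1" .
  then show ?thesis using assms False by (simp add: field_simps)
qed (use assms in simp)

text \<open>For \<open>q = 0\<close> the factor \<open>1 / hoyt_gamma\<close> is not integrable near
  \<open>t = 0\<close>; the exponential compensates for this only when \<open>x > 0\<close>.\<close>

lemma hoyt_density_integrable:
  assumes "0 < g" "0 \<le> q" "q \<le> 1" "0 < x"
  shows "set_integrable lborel {0..pi} (\<lambda>t. 1 / hoyt_gamma g t q * exp (- (x / hoyt_gamma g t q)))"
proof (rule set_integrable_bounded_0_pi)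
  show "\<bar>1 / hoyt_gamma g t q * exp (- (x / hoyt_gamma g t q))\<bar> \<le> 1 / x" for t
    using inverse_exp_le[of x "hoyt_gamma g t q"] hoyt_gamma_bounds(1)[of g q t] assms by simp
qed measurable

lemma hoyt_density_eq_pdf:
  assumes "0 < g" "0 < q" "q \<le> 1"
  shows "1 / pi * (LBINT t:{0..pi}. 1 / hoyt_gamma g t q * exp (- (x / hoyt_gamma g t q))) =
    squared_hoyt_pdf g q x"
proof -
  have "continuous_on {0..pi} (\<lambda>t. 1 / hoyt_gamma g t q * exp (- (x / hoyt_gamma g t q)))"
    using hoyt_gamma_pos_nondegenerate[OF assms]
    by (intro continuous_intros continuous_hoyt_gamma) (auto simp: less_imp_neq[THEN not_sym])
  then have "set_integrable lborel {0..pi} (\<lambda>t. 1 / hoyt_gamma g t q * exp (- (x / hoyt_gamma g t q)))"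
    by (rule borel_integrable_atLeastAtMost')
  then have "(LBINT t:{0..pi}. 1 / hoyt_gamma g t q * exp (- (x / hoyt_gamma g t q))) =
      integral {0..pi} (\<lambda>t. 1 / hoyt_gamma g t q * exp (- (x / hoyt_gamma g t q)))"
    by (rule set_borel_integral_eq_integral)
  also have "\<dots> = pi * squared_hoyt_pdf g q x"
    using hoyt_density_has_integral[OF assms] by (rule integral_unique)
  finally show ?thesis by simp
qed

text \<open>For small positive \<open>p\<close> the Bessel expression is the mixture integral, and
  dominated convergence with the constant \<open>1 / x\<close> takes the limit under the
  integral.\<close>

lemma squared_hoyt_pdf_tendsto:
  assumes g: "0 < g" and x: "0 < x"
  shows "((\<lambda>p. squared_hoyt_pdf g p x) \<longlongrightarrow>
    1 / pi * (LBINT t:{0..pi}. 1 / hoyt_gamma g t 0 * exp (- (x / hoyt_gamma g t 0)))) (at_right 0)"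
proof (rule tendsto_at_right_sequentially[OF zero_less_one])
  fix p :: "nat \<Rightarrow> real"
  assume p: "\<And>n. 0 < p n" "\<And>n. p n < 1" "p \<longlonglongrightarrow> 0"
  let ?h = "\<lambda>q t. 1 / hoyt_gamma g t q * exp (- (x / hoyt_gamma g t q))"
  have "(\<lambda>n. LBINT t:{0..pi}. ?h (p n) t) \<longlonglongrightarrow> (LBINT t:{0..pi}. ?h 0 t)"
    unfolding set_lebesgue_integral_def
  proof (rule integral_dominated_convergence[where w = "\<lambda>t. indicator {0..pi} t *\<^sub>R (1 / x)"])
    show "integrable lborel (\<lambda>t. indicator {0..pi} t *\<^sub>R (1 / x))"
      using set_integrable_bounded_0_pi[of "\<lambda>_. 1 / x" "1 / x"] x by (simp add: set_integrable_def)
    have "\<bar>?h (p n) t\<bar> \<le> 1 / x" for n t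
      using inverse_exp_le[OF x, of "hoyt_gamma g t (p n)"] hoyt_gamma_bounds(1)[OF g, of "p n" t]
        p(1,2)[of n] by (simp add: less_imp_le)
    then show "AE t in lborel. norm (indicator {0..pi} t *\<^sub>R ?h (p n) t) \<le> indicator {0..pi} t *\<^sub>R (1 / x)" for n
      by (intro AE_I2) (auto split: split_indicator)
    \<comment> \<open>The limiting mean is 0 at \<open>t = 0\<close>, so pointwise convergence is
      shown only for positive angles.\<close>
    have conv: "(\<lambda>n. ?h (p n) t) \<longlonglongrightarrow> ?h 0 t" if "0 < t" "t \<le> pi" for t
    proof -
      have "(\<lambda>n. hoyt_gamma g t (p n)) \<longlonglongrightarrow> hoyt_gamma g t 0"
        unfolding hoyt_gamma_def using p(3) by (intro tendsto_intros) auto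
      moreover have "hoyt_gamma g t 0 \<noteq> 0" using hoyt_gamma_pos[of g 0 t] g that by simp
      ultimately show ?thesis by (intro tendsto_intros)
    qed
    show "AE t in lborel. (\<lambda>n. indicator {0..pi} t *\<^sub>R ?h (p n) t) \<longlonglongrightarrow> indicator {0..pi} t *\<^sub>R ?h 0 t"
      using AE_lborel_singleton[of 0] 
    proof eventually_elim
      case (elim t)
      then show ?case
        using conv[of t] by (cases "t \<in> {0..pi}") simp_all
    qed
  qed measurable
  then have "(\<lambda>n. 1 / pi * (LBINT t:{0..pi}. ?h (p n) t)) \<longlonglongrightarrow> 1 / pi * (LBINT t:{0..pi}. ?h 0 t)"
    by (intro tendsto_intros)
  then show "(\<lambda>n. squared_hoyt_pdf g (p n) x) \<longlonglongrightarrow> 1 / pi * (LBINT t:{0..pi}. ?h 0 t)"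
    using hoyt_density_eq_pdf[OF g p(1)] p(2) by (simp add: less_imp_le)
qed

section \<open>Conditional mean, density, cdf and Gaussian representation of the mixture\<close>

theorem lemma1:
  fixes M :: "'a measure" and \<Theta> R :: "'a \<Rightarrow> real" and g q :: real
  assumes "prob_space M"
    and "0 < g" and "0 \<le> q" and "q \<le> 1"
    and "\<Theta> \<in> borel_measurable M" and "R \<in> borel_measurable M"
    and "distr M borel \<Theta> = uniform_measure lborel {0..pi}"
    and "conditional_pdf M \<Theta> R (\<lambda>\<theta>. exponential_density (1 / hoyt_gamma g \<theta> q))"
  shows "(AE \<omega> in M. real_cond_exp M (vimage_algebra (space M) \<Theta> borel) R \<omega>
            = hoyt_gamma g (\<Theta> \<omega>) q)
    \<and> distributed M lborel R (\<lambda>x. ennreal (if 0 \<le> x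
          then 1 / pi * (LBINT \<theta>:{0..pi}. 1 / hoyt_gamma g \<theta> q * exp (- (x / hoyt_gamma g \<theta> q)))
          else 0))
    \<and> squared_hoyt g q (distr M borel R)
    \<and> prob_space.expectation M R = g
    \<and> (0 < q \<longrightarrow> (\<forall>x\<ge>0.
          1 / pi * (LBINT \<theta>:{0..pi}. 1 / hoyt_gamma g \<theta> q * exp (- (x / hoyt_gamma g \<theta> q)))
            = squared_hoyt_pdf g q x))
    \<and> (q = 0 \<longrightarrow> (\<forall>x>0.
          ((\<lambda>p. squared_hoyt_pdf g p x) \<longlongrightarrow>
            1 / pi * (LBINT \<theta>:{0..pi}. 1 / hoyt_gamma g \<theta> q * exp (- (x / hoyt_gamma g \<theta> q))))
            (at_right 0)))
    \<and> (\<forall>x\<ge>0. cdf (distr M borel R) x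
          = 1 - 1 / pi * (LBINT \<theta>:{0..pi}. exp (- (x / hoyt_gamma g \<theta> q))))"
proof -
  note M = assms(1) and g = assms(2) and q = assms(3,4) and cond = assms(8)
  interpret M: prob_space M by fact
  note [measurable] = assms(5,6)
  let ?U = "uniform_measure lborel {0..pi}"
  let ?\<gamma> = "\<lambda>t. hoyt_gamma g t q"
  let ?f = "\<lambda>t. exponential_density (1 / ?\<gamma> t)"
  let ?p = "\<lambda>x. 1 / pi * (LBINT t:{0..pi}. 1 / ?\<gamma> t * exp (- (x / ?\<gamma> t)))"
  have gamma_nonneg: "0 \<le> ?\<gamma> t" for t by (rule hoyt_gamma_bounds(1)[OF g q])
  \<comment> \<open>The mean can vanish only at angle 0, a null set, so almost every conditional law
    is a genuine exponential law.\<close>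
  have AE_pos: "AE t in ?U. 0 < ?\<gamma> t"
  proof (rule AE_uniform_measureI)
    show "AE t in lborel. t \<in> {0..pi} \<longrightarrow> 0 < ?\<gamma> t"
      using AE_lborel_singleton[of 0] by eventually_elim (auto intro: hoyt_gamma_pos[OF g q])
  qed simp
  \<comment> \<open>Here \<open>c t\<close> is the conditional expectation of the test function
    given the angle \<open>t\<close>. The support, the mean and the cdf of \<open>R\<close> all come
    from this identity by choosing \<open>h\<close>.\<close>
  have law: "(\<integral>\<^sup>+\<omega>. h (R \<omega>) * indicator A (\<Theta> \<omega>) \<partial>M) = (\<integral>\<^sup>+t. c t * indicator A t \<partial>?U)"
    if "h \<in> borel_measurable borel" "A \<in> sets borel"
      and c: "\<And>l. 0 < ?\<gamma> l \<Longrightarrow> (\<integral>\<^sup>+x. h x * ennreal (?f l x) \<partial>lborel) = c l" for h A c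
  proof -
    have "(\<integral>\<^sup>+\<omega>. h (R \<omega>) * indicator A (\<Theta> \<omega>) \<partial>M) =
        (\<integral>\<^sup>+t\<in>A. (\<integral>\<^sup>+x. h x * ennreal (?f t x) \<partial>lborel) \<partial>?U)"
      using conditional_pdf_nn_integral[OF M cond that(2,1)] by (simp only: assms(7))
    also have "\<dots> = (\<integral>\<^sup>+t. c t * indicator A t \<partial>?U)"
    proof (rule nn_integral_cong_AE)
      show "AE t in ?U. (\<integral>\<^sup>+x. h x * ennreal (?f t x) \<partial>lborel) * indicator A t = c t * indicator A t"
        using AE_pos by eventually_elim (simp only: c)
    qed
    finally show ?thesis .
  qed
  \<comment> \<open>Nonnegativity is what allows \<open>R\<close> to be recovered from
    \<open>ennreal (R \<omega>)\<close>, which sends negative values to 0.\<close>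
  have R_nonneg: "AE \<omega> in M. 0 \<le> R \<omega>"
  proof -
    have "(\<integral>\<^sup>+\<omega>. indicator {..<0} (R \<omega>) * indicator UNIV (\<Theta> \<omega>) \<partial>M) = (\<integral>\<^sup>+t. 0 * indicator UNIV t \<partial>?U)"
      by (rule law) (auto intro: nn_integral_exponential(2))
    then have "(\<integral>\<^sup>+\<omega>. indicator {..<0} (R \<omega>) \<partial>M) = 0" by simp
    then have "AE \<omega> in M. indicator {..<0} (R \<omega>) = (0::ennreal)"
      by (subst (asm) nn_integral_0_iff_AE) measurable
    then show ?thesis by eventually_elim (auto split: split_indicator_asm)
  qed
  have cond_mean: "(\<integral>\<^sup>+\<omega>. ennreal (R \<omega>) * indicator A (\<Theta> \<omega>) \<partial>M) =
      (\<integral>\<^sup>+\<omega>. ennreal (?\<gamma> (\<Theta> \<omega>)) * indicator A (\<Theta> \<omega>) \<partial>M)" if [measurable]: "A \<in> sets borel" for A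
  proof -
    have "(\<integral>\<^sup>+\<omega>. ennreal (R \<omega>) * indicator A (\<Theta> \<omega>) \<partial>M) = (\<integral>\<^sup>+t. ennreal (?\<gamma> t) * indicator A t \<partial>?U)"
      by (rule law) (auto simp: nn_integral_exponential(1))
    also have "\<dots> = (\<integral>\<^sup>+\<omega>. ennreal (?\<gamma> (\<Theta> \<omega>)) * indicator A (\<Theta> \<omega>) \<partial>M)"
      unfolding assms(7)[symmetric] by (subst nn_integral_distr) auto
    finally show ?thesis .
  qed
  have int_gamma: "integrable M (\<lambda>\<omega>. ?\<gamma> (\<Theta> \<omega>))"
    using gamma_nonneg hoyt_gamma_bounds(2)[OF g q]
    by (intro M.integrable_const_bound[where B = "2 * g"]) auto
  have int_R: "integrable M R"
  proof (rule integrableI_nonneg)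
    have "(\<integral>\<^sup>+\<omega>. ennreal (R \<omega>) \<partial>M) = (\<integral>\<^sup>+\<omega>. ennreal (?\<gamma> (\<Theta> \<omega>)) \<partial>M)"
      using cond_mean[of UNIV] by simp
    also have "\<dots> < \<infinity>"
      using int_gamma gamma_nonneg by (simp add: integrable_iff_bounded)
    finally show "(\<integral>\<^sup>+\<omega>. ennreal (R \<omega>) \<partial>M) < \<infinity>" .
  qed (use R_nonneg in auto)
  have set_mean: "(\<integral>\<omega>. indicator A (\<Theta> \<omega>) * R \<omega> \<partial>M) = (\<integral>\<omega>. indicator A (\<Theta> \<omega>) * ?\<gamma> (\<Theta> \<omega>) \<partial>M)"
    if [measurable]: "A \<in> sets borel" for A
  proof -
    have ind: "ennreal (indicator A t * y) = ennreal y * indicator A t" for t y :: real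
      by (simp split: split_indicator)
    have "(\<integral>\<omega>. indicator A (\<Theta> \<omega>) * R \<omega> \<partial>M) = enn2real (\<integral>\<^sup>+\<omega>. ennreal (R \<omega>) * indicator A (\<Theta> \<omega>) \<partial>M)"
      unfolding ind[symmetric] using R_nonneg by (intro integral_eq_nn_integral) auto
    also have "\<dots> = (\<integral>\<omega>. indicator A (\<Theta> \<omega>) * ?\<gamma> (\<Theta> \<omega>) \<partial>M)"
      unfolding cond_mean[OF that] unfolding ind[symmetric]
      using gamma_nonneg by (intro integral_eq_nn_integral[symmetric]) auto
    finally show ?thesis .
  qed

  have cexp: "AE \<omega> in M. real_cond_exp M (vimage_algebra (space M) \<Theta> borel) R \<omega> = ?\<gamma> (\<Theta> \<omega>)"
  proof -
    let ?F = "vimage_algebra (space M) \<Theta> borel"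
    \<comment> \<open>Every event generated by \<open>\<Theta>\<close> is the preimage of a Borel
      set, so \<open>set_mean\<close> is exactly the averaging property that characterizes the
      conditional expectation.\<close>
    have F: "A \<in> sets ?F \<longleftrightarrow> (\<exists>B\<in>sets borel. A = \<Theta> -` B \<inter> space M)" for A
      by (auto simp: sets_vimage_algebra2)
    have "finite_measure_subalgebra M ?F"
      by unfold_locales (auto simp: subalgebra_def F)
    then interpret F: finite_measure_subalgebra M ?F .
    show ?thesis
    proof (rule F.real_cond_exp_charact)
      fix A assume "A \<in> sets ?F"
      then obtain B where B: "B \<in> sets borel" "A = \<Theta> -` B \<inter> space M" by (auto simp: F)
      have A: "(\<integral>\<omega>\<in>A. h \<omega> \<partial>M) = (\<integral>\<omega>. indicator B (\<Theta> \<omega>) * h \<omega> \<partial>M)" for h :: "'a \<Rightarrow> real"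
        unfolding set_lebesgue_integral_def B(2)
        by (intro Bochner_Integration.integral_cong) (auto split: split_indicator)
      show "(\<integral>\<omega>\<in>A. R \<omega> \<partial>M) = (\<integral>\<omega>\<in>A. ?\<gamma> (\<Theta> \<omega>) \<partial>M)"
        unfolding A by (rule set_mean[OF B(1)])
    next
      have "\<Theta> \<in> borel_measurable ?F" by (rule measurable_vimage_algebra1) auto
      from measurable_compose[OF this measurable_hoyt_gamma]
      show "(\<lambda>\<omega>. ?\<gamma> (\<Theta> \<omega>)) \<in> borel_measurable ?F" .
    qed (rule int_R int_gamma)+
  qed

  have mean: "M.expectation R = g"
  proof -
    \<comment> \<open>By \<open>set_mean\<close> on the whole line, \<open>R\<close> has the same
      mean as \<open>?\<gamma>\<close> of the uniform angle; the cosine term averages to zero over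
      \<open>{0..pi}\<close>.\<close>
    have int: "set_integrable lborel {0..pi} ?\<gamma>"
      by (intro borel_integrable_atLeastAtMost' continuous_hoyt_gamma)
    have "(\<integral>\<^sup>+\<omega>. ennreal (?\<gamma> (\<Theta> \<omega>)) \<partial>M) = (\<integral>\<^sup>+t. ennreal (?\<gamma> t) \<partial>?U)"
      unfolding assms(7)[symmetric] by (subst nn_integral_distr) auto
    also have "\<dots> = ennreal (1 / pi * (LBINT t:{0..pi}. ?\<gamma> t))"
      by (rule nn_integral_uniform_0_pi[OF _ gamma_nonneg int]) measurable
    also have "(LBINT t:{0..pi}. ?\<gamma> t) = integral {0..pi} ?\<gamma>"
      by (rule set_borel_integral_eq_integral[OF int])
    also have "\<dots> = g * pi"
    proof (rule integral_unique)
      let ?k = "(1 - q\<^sup>2) / (1 + q\<^sup>2)"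
      have "1 + q\<^sup>2 \<noteq> 0" using zero_le_power2[of q] by linarith
      then have "(?\<gamma> has_integral (g * (pi - ?k * sin pi) - g * (0 - ?k * sin 0))) {0..pi}"
        unfolding hoyt_gamma_def
        by (intro fundamental_theorem_of_calculus)
          (auto simp: has_real_derivative_iff_has_vector_derivative[symmetric]
            intro!: derivative_eq_intros)
      then show "(?\<gamma> has_integral g * pi) {0..pi}" by simp
    qed
    finally have "(\<integral>\<^sup>+\<omega>. ennreal (?\<gamma> (\<Theta> \<omega>)) \<partial>M) = ennreal g" by simp
    then have "M.expectation (\<lambda>\<omega>. ?\<gamma> (\<Theta> \<omega>)) = g"
      using gamma_nonneg g by (subst integral_eq_nn_integral) auto
    then show ?thesis using set_mean[of UNIV] by simp
  qed

  have dens: "distributed M lborel R (\<lambda>x. ennreal (if 0 \<le> x then ?p x else 0))"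
  proof -
    have [measurable]: "?p \<in> borel_measurable borel"
      unfolding set_lebesgue_integral_def by measurable
    have "distr M lborel R = distr M borel R" by (rule distr_cong) auto
    also have "\<dots> = density lborel (\<lambda>x. \<integral>\<^sup>+t. ennreal (?f t x) \<partial>?U)"
      using conditional_pdf_distr[OF M cond] by (simp only: assms(7))
    also have "\<dots> = density lborel (\<lambda>x. ennreal (if 0 \<le> x then ?p x else 0))"
    proof (rule density_cong)
      have [measurable]: "(\<lambda>(t, x). ?f t x) \<in> borel_measurable (borel \<Otimes>\<^sub>M borel)"
        using cond by (simp add: conditional_pdf_def)
      interpret U: prob_space ?U by (rule prob_space_uniform_measure) auto
      have [measurable_cong]: "sets ?U = sets borel" by simp
      show "(\<lambda>x. \<integral>\<^sup>+t. ennreal (?f t x) \<partial>?U) \<in> borel_measurable lborel" by measurable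
      \<comment> \<open>The point 0 is left out: for \<open>q = 0\<close> the nonnegative integral
        is infinite there, while the Lebesgue integral takes its default value 0.\<close>
      have "(\<integral>\<^sup>+t. ennreal (?f t x) \<partial>?U) = ennreal (if 0 \<le> x then ?p x else 0)" if "x \<noteq> 0" for x
      proof (cases "0 < x")
        case True
        then have "?f t x = 1 / ?\<gamma> t * exp (- (x / ?\<gamma> t))" for t by (simp add: exponential_density_def)
        then have "(\<integral>\<^sup>+t. ennreal (?f t x) \<partial>?U) = (\<integral>\<^sup>+t. ennreal (1 / ?\<gamma> t * exp (- (x / ?\<gamma> t))) \<partial>?U)"
          by simp
        also have "\<dots> = ennreal (?p x)"
          using gamma_nonneg by (intro nn_integral_uniform_0_pi hoyt_density_integrable g q True) auto
        finally show ?thesis using True by simp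
      next
        case False
        with that show ?thesis by (simp add: exponential_density_def)
      qed
      then show "AE x in lborel. (\<integral>\<^sup>+t. ennreal (?f t x) \<partial>?U) = ennreal (if 0 \<le> x then ?p x else 0)"
        using AE_lborel_singleton[of 0] by (auto elim!: eventually_mono)
    qed measurable
    finally show ?thesis unfolding distributed_def by simp
  qed

  have cdf: "cdf (distr M borel R) x = 1 - 1 / pi * (LBINT t:{0..pi}. exp (- (x / ?\<gamma> t)))"
    if x: "0 \<le> x" for x
  proof -
    let ?I = "LBINT t:{0..pi}. exp (- (x / ?\<gamma> t))"
    interpret D: real_distribution "distr M borel R" by simp
    \<comment> \<open>The upper tail is computed first, because given the angle it is a single
      exponential; the cdf is its complement.\<close>
    have "emeasure (distr M borel R) {x<..} = (\<integral>\<^sup>+y. indicator {x<..} y \<partial>distr M borel R)" by simp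
    also have "\<dots> = (\<integral>\<^sup>+\<omega>. indicator {x<..} (R \<omega>) * indicator UNIV (\<Theta> \<omega>) \<partial>M)"
      by (subst nn_integral_distr) auto
    also have "\<dots> = (\<integral>\<^sup>+t. ennreal (exp (- (x / ?\<gamma> t))) * indicator UNIV t \<partial>?U)"
      using x by (intro law) (auto simp: nn_integral_exponential(3))
    also have "\<dots> = (\<integral>\<^sup>+t. ennreal (exp (- (x / ?\<gamma> t))) \<partial>?U)" by simp
    also have "\<dots> = ennreal (1 / pi * ?I)"
      using x gamma_nonneg
      by (intro nn_integral_uniform_0_pi set_integrable_bounded_0_pi[where B = 1]) auto
    finally have "measure (distr M borel R) {x<..} = 1 / pi * ?I"
      by (intro measure_eq_emeasure_eq_ennreal) (auto simp: set_lebesgue_integral_def)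
    moreover have "measure (distr M borel R) {..x} = 1 - measure (distr M borel R) {x<..}"
      using D.prob_compl[of "{x<..}"] by (simp add: Compl_eq_Diff_UNIV[symmetric])
    ultimately show ?thesis by (simp add: cdf_def2)
  qed

  have "squared_hoyt g q (distr M borel R)"
    using cdf by (intro squared_hoyt_of_cdf g q) auto
  then show ?thesis
    using cexp dens mean cdf hoyt_density_eq_pdf[OF g _ q(2)] squared_hoyt_pdf_tendsto[OF g] by blast
qed

end
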